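(* Let $X$ be a $(d\times N)$-matrix of full rank $d\le N$ with entries in $\mathbb{R}$. Let $k\neq 1$ be a non-negative real number. Then $X$ represents a regular matroid if and only if the following condition is satisfied: there is a $(d\times N)$-matrix $X_k$ with entries in $\mathbb{R}$ such that for each $I\in\binom{[N]}{d}$, $$|\Delta_I(X)|^k = |\Delta_I(X_k)| .$$ If $k\neq 1$ is a non-negative integer, then the same statement holds with $\mathbb{R}$ replaced by any ordered field $\mathbb{K}$.
   Context: $[N]=\{1,\dots,N\}$ and $\binom{[N]}{d}$ is the set of $d$-element subsets of $[N]$. For a $(d\times N)$-matrix $X$ and $I\in\binom{[N]}{d}$, $\Delta_I(X)$ is the maximal minor of $X$ indexed by $I$, i.e. the determinant of the square submatrix formed by the columns indexed by $I$. The matroid represented by $X$ is the matroid on $[N]$ whose rank function is the linear rank of sets of columns. A matroid is regular if it can be represented over every field, equivalently if it can be represented by a totally unimodular matrix (a matrix all of whose non-singular square submatrices have determinant $\pm1$); the representing matrix $X$ itself need not be totally unimodular. In an ordered field, $|x|=x$ if $x\ge 0$ and $|x|=-x$ if $x<0$. The convention $0^0=0$ is used. *)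

theory Defs
  imports
    Complex_Main
    "HOL-Library.FuncSet"
    "Jordan_Normal_Form.DL_Submatrix"
    "Jordan_Normal_Form.DL_Rank"
begin

text \<open>
  Matrices are those of \<^theory>\<open>Jordan_Normal_Form.Matrix\<close>, whose rows and columns are
  numbered from 0; hence the index set $[N]$ is rendered as \<^term>\<open>{..<N}\<close>.
\<close>

text \<open>\<^const>\<open>submatrix\<close> keeps the chosen columns in increasing order.\<close>

definition maximal_minor :: "'a::comm_ring_1 mat \<Rightarrow> nat set \<Rightarrow> 'a" where
  "maximal_minor X I = det (submatrix X UNIV I)"

text \<open>
  A matroid is given by its ground set and its rank function. The rank function is restricted
  to the subsets of the ground set, so that equality of such pairs is equality of matroids.
\<close>

type_synonym matroid = "nat set \<times> (nat set \<Rightarrow> nat)"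

definition column_matroid :: "'a::field mat \<Rightarrow> matroid" where
  "column_matroid X =
     ({..<dim_col X},
      \<lambda>S\<in>Pow {..<dim_col X}. vec_space.rank (dim_row X) (submatrix X UNIV S))"

definition represents :: "'a::field mat \<Rightarrow> matroid \<Rightarrow> bool" where
  "represents X M \<longleftrightarrow> column_matroid X = M"

definition totally_unimodular :: "'a::comm_ring_1 mat \<Rightarrow> bool" where
  "totally_unimodular A \<longleftrightarrow>
     (\<forall>I J. I \<subseteq> {..<dim_row A} \<longrightarrow> J \<subseteq> {..<dim_col A} \<longrightarrow> card I = card J \<longrightarrow>
        det (submatrix A I J) \<noteq> 0 \<longrightarrow> det (submatrix A I J) \<in> {1, -1})"

text \<open>
  Regularity is representability by a totally unimodular real matrix, with any number of rows.
  This is one of the two standard definitions; the other one, representability over every field,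
  would need a quantification over types.
\<close>

definition regular_matroid :: "matroid \<Rightarrow> bool" where
  "regular_matroid M \<longleftrightarrow> (\<exists>A::real mat. totally_unimodular A \<and> represents A M)"

text \<open>
  Natural powers with the convention $0^0 = 0$. For real exponents \<^const>\<open>powr\<close> already
  satisfies \<^prop>\<open>(0::real) powr k = 0\<close> for every \<^term>\<open>k\<close>, including \<^term>\<open>k = 0\<close>.
\<close>

definition power_zero :: "'a::linordered_field \<Rightarrow> nat \<Rightarrow> 'a" where
  "power_zero x k = (if x = 0 then 0 else x ^ k)"

end

theory Submission
  imports Defs "Jordan_Normal_Form.DL_Rank_Submatrix"
begin

text \<open>
  Everything happens on the function \<open>f I = \<bar>\<Delta>\<^sub>I(X)\<bar>\<close> on \<open>d\<close>-element sets, and the link between the two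
  sides of the equivalence is the absence of a four-point line as a minor: no set \<open>S\<close> of size
  \<open>d - 2\<close> and elements \<open>a, b, c, e\<close> are such that all six sets \<open>S \<union> {x, y}\<close> are bases.

  The three-term Pluecker relation, read for absolute values, says that of the three numbers
  \<open>f(Sab) f(Sce)\<close>, \<open>f(Sac) f(Sbe)\<close>, \<open>f(Sae) f(Sbc)\<close> one is the sum of the two others
  (\<open>three_term_balanced\<close>). If there were a four-point line, the three numbers would be positive, and
  the existence of \<open>X\<^sub>k\<close> would make their \<open>k\<close>-th powers satisfy such a relation too, so that
  \<open>(u + v)\<^sup>k = u\<^sup>k + v\<^sup>k\<close> for some positive \<open>u, v\<close>, which forces \<open>k = 1\<close>. Regularity excludes a
  four-point line by the case \<open>k = 0\<close> of this argument: \<open>d\<close> suitable rows of a totally unimodular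
  representation have maximal minors \<open>0, \<plusminus>1\<close>, supported on the same bases, and \<open>1\<close> is not
  \<open>1 + 1\<close> (\<open>U24_minor_balanced_triple\<close>).

  Conversely, without a four-point line one of the three products is always \<open>0\<close>, so the other two
  are equal. From these multiplicative relations and basis exchange alone it follows that
  \<open>f I = c \<Prod>\<^sub>i\<^sub>\<in>\<^sub>I h\<^sub>i\<close> on all bases, for some positive constants (\<open>rescale_to_unit\<close>). This is the
  core of the proof; the lemma states it with inverse constants. Fix a basis \<open>J\<close>. The values at the neighbours \<open>J - i + e\<close> are the weights of a
  bipartite graph, and they come from potentials because every chordless cycle has trivial
  gain: a pivot shortens the cycle by two edges and preserves its gain, and for a cycle of length four
  the relation is the three-term relation itself. Once the neighbours of \<open>J\<close> have value \<open>1\<close>, so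
  have all bases, by induction on the distance from \<open>J\<close>.

  The product formula gives both properties at once. Dividing column \<open>i\<close> by \<open>h\<^sub>i\<close> and
  multiplying by the inverse of a basis turns \<open>X\<close> into a matrix that contains the identity and has
  maximal minors \<open>0, \<plusminus>1\<close>; every square submatrix extends to a maximal one by unit columns, so
  it is totally unimodular, and its entries \<open>0, \<plusminus>1\<close> may be read in \<open>\<real>\<close>
  (\<open>regular_if_rescalable\<close>). Rescaling the columns of \<open>X\<close> by \<open>h\<^sub>i\<^sup>k\<^sup>-\<^sup>1\<close> and one row by
  \<open>c\<^sup>k\<^sup>-\<^sup>1\<close> gives \<open>X\<^sub>k\<close>.

  Real and natural exponents are treated together: all that matters is that \<open>\<phi> x = x\<^sup>k\<close> is
  multiplicative on positive numbers and lies strictly on one side of the identity on \<open>(0, 1)\<close>.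
\<close>

section \<open>Positive functions on bases without a four-point line\<close>

text \<open>
  The shape of a three-term relation \<open>x = \<plusminus>y \<plusminus>z\<close> between nonnegative numbers when one of them vanishes.
\<close>

definition degenerate_three_term :: "'a::zero \<Rightarrow> 'a \<Rightarrow> 'a \<Rightarrow> bool" where
  "degenerate_three_term x y z \<longleftrightarrow> (x = 0 \<and> y = z) \<or> (y = 0 \<and> x = z) \<or> (z = 0 \<and> x = y)"

text \<open>
  The axioms keep what is known of \<open>\<bar>\<Delta>\<^sub>I(X)\<bar>\<close> when the matroid has no four-point line; the sets
  with nonzero value are the bases. The relations are homogeneous in each element, so the structure
  survives rescaling by weights of the elements.
\<close>

locale binary_valuation =
  fixes E :: "'b set" and f :: "'b set \<Rightarrow> 'a::linordered_field"
  assumes finite_ground: "finite E"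
    and nonneg: "f I \<ge> 0"
    and support: "f I \<noteq> 0 \<Longrightarrow> I \<subseteq> E"
    and exchange: "f I \<noteq> 0 \<Longrightarrow> f J \<noteq> 0 \<Longrightarrow> e \<in> I - J \<Longrightarrow> \<exists>i\<in>J - I. f (insert i (I - {e})) \<noteq> 0"
    and three_term: "distinct [a, b, c, e] \<Longrightarrow> {a, b, c, e} \<inter> S = {} \<Longrightarrow>
      degenerate_three_term (f (insert a (insert b S)) * f (insert c (insert e S)))
             (f (insert a (insert c S)) * f (insert b (insert e S)))
             (f (insert a (insert e S)) * f (insert b (insert c S)))"

lemma (in binary_valuation) rescale:
  fixes c :: 'a
  assumes c: "c > 0" and h: "\<And>x. h x > 0"
  shows "binary_valuation E (\<lambda>I. c * f I * prod h I)"
proof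
  note pos = prod_pos[of _ h, OF h]
  have nz: "prod h I \<noteq> 0" for I using pos[of I] by simp
  show "finite E" by (rule finite_ground)
  show "c * f I * prod h I \<ge> 0" for I using nonneg[of I] c pos[of I] by simp
  show "c * f I * prod h I \<noteq> 0 \<Longrightarrow> I \<subseteq> E" for I using support[of I] by auto
  show "c * f I * prod h I \<noteq> 0 \<Longrightarrow> c * f J * prod h J \<noteq> 0 \<Longrightarrow> e \<in> I - J \<Longrightarrow>
      \<exists>i\<in>J - I. c * f (insert i (I - {e})) * prod h (insert i (I - {e})) \<noteq> 0" for I J e
    using exchange[of I J e] c nz by auto
  show "degenerate_three_term (c * f (insert a (insert b S)) * prod h (insert a (insert b S)) *
                (c * f (insert p (insert e S)) * prod h (insert p (insert e S))))
             (c * f (insert a (insert p S)) * prod h (insert a (insert p S)) *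
                (c * f (insert b (insert e S)) * prod h (insert b (insert e S))))
             (c * f (insert a (insert e S)) * prod h (insert a (insert e S)) *
                (c * f (insert b (insert p S)) * prod h (insert b (insert p S))))"
    if d: "distinct [a, b, p, e]" "{a, b, p, e} \<inter> S = {}" for a b p e S
  proof (cases "finite S")
    case True
    define k where "k = c * c * h a * h b * h p * h e * prod h S * prod h S"
    have eq: "c * f (insert x (insert y S)) * prod h (insert x (insert y S)) *
                (c * f (insert z (insert w S)) * prod h (insert z (insert w S))) =
            (c * c * h x * h y * h z * h w * prod h S * prod h S) *
            (f (insert x (insert y S)) * f (insert z (insert w S)))"
      if "x \<notin> S" "y \<notin> S" "z \<notin> S" "w \<notin> S" "x \<noteq> y" "z \<noteq> w" for x y z w
      using that True by (simp add: mult_ac)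
    have scale: "degenerate_three_term (k * x) (k * y) (k * z)" if "degenerate_three_term x y z" for x y z
      using that by (auto simp: degenerate_three_term_def)
    have k: "c * c * h a * h b * h p * h e * prod h S * prod h S = k"
      "c * c * h a * h p * h b * h e * prod h S * prod h S = k"
      "c * c * h a * h e * h b * h p * prod h S * prod h S = k"
      by (simp_all add: k_def mult_ac)
    have out: "a \<notin> S" "b \<notin> S" "p \<notin> S" "e \<notin> S" "a \<noteq> b" "a \<noteq> p" "a \<noteq> e" "p \<noteq> e" "b \<noteq> e" "b \<noteq> p"
      using d by auto
    show ?thesis
      unfolding eq[OF out(1-4,5,8)] eq[OF out(1,3,2,4,6,9)] eq[OF out(1,4,2,3,7,10)] k
      by (rule scale[OF three_term[OF d]])
  next
    case False
    then have "f (insert x (insert y S)) = 0" for x y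
      using support[of "insert x (insert y S)"] finite_ground finite_subset by fastforce
    then show ?thesis by (simp add: degenerate_three_term_def)
  qed
qed

context binary_valuation begin

text \<open>
  The three-term relation around \<open>J - {i, j}\<close>, written with neighbours of \<open>J\<close>. In matrix terms: how an
  entry changes when the basis \<open>J\<close> is replaced by \<open>J - i + x\<close>.
\<close>

lemma pivot:
  assumes "i \<in> J" "j \<in> J" "i \<noteq> j" "x \<notin> J" "y \<notin> J" "x \<noteq> y"
  shows "degenerate_three_term (f J * f (insert y (insert x (J - {i}) - {j})))
     (f (insert x (J - {i})) * f (insert y (J - {j})))
     (f (insert y (J - {i})) * f (insert x (J - {j})))"
proof -
  let ?S = "J - {i, j}"
  have "insert i (insert j ?S) = J" "insert j (insert x ?S) = insert x (J - {i})"
    "insert i (insert x ?S) = insert x (J - {j})" "insert j (insert y ?S) = insert y (J - {i})"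
    "insert i (insert y ?S) = insert y (J - {j})"
    "insert x (insert y ?S) = insert y (insert x (J - {i}) - {j})"
    using assms by auto
  with three_term[of i j y x ?S] assms show ?thesis 
    by (auto simp: degenerate_three_term_def insert_commute mult.commute)
qed

text \<open>
  The elements \<open>i 0, e 0, i 1, \<dots>, e (n - 1), i n\<close> form an induced path in the bipartite graph of \<open>J\<close>,
  with all weights \<open>1\<close>, which \<open>v\<close> closes to a chordless cycle; the claim is that the two remaining
  weights agree. Exchanging \<open>i 0\<close> for \<open>e 0\<close> deletes the first two vertices and leaves
  all weights of the rest unchanged, except that the edge from \<open>v\<close> to \<open>i 0\<close> is moved
  to \<open>i 1\<close>. Chordlessness is what makes the third product of the pivot relation vanish elsewhere.
\<close>

lemma chordless_path:
  assumes "f J = 1" "inj_on i {..n}" "i ` {..n} \<subseteq> J" "inj_on e {..<n}" "e ` {..<n} \<inter> J = {}"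
    and "v \<notin> J" "v \<notin> e ` {..<n}" "0 < n"
    and "\<And>t s. t \<le> n \<Longrightarrow> s < n \<Longrightarrow>
           f (insert (e s) (J - {i t})) = (if t = s \<or> t = Suc s then 1 else 0)"
    and "f (insert v (J - {i 0})) \<noteq> 0" "f (insert v (J - {i n})) \<noteq> 0"
    and "\<And>t. 0 < t \<Longrightarrow> t < n \<Longrightarrow> f (insert v (J - {i t})) = 0"
  shows "f (insert v (J - {i 0})) = f (insert v (J - {i n}))"
  using assms
proof (induction n arbitrary: J i e)
  case 0
  then show ?case by simp
next
  case (Suc n)
  note J = Suc.prems(1) and i = Suc.prems(2,3) and e = Suc.prems(4,5) and v = Suc.prems(6,7)
    and w = Suc.prems(9) and v0 = Suc.prems(10) and vn = Suc.prems(11) and vt = Suc.prems(12)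
  have ne: "i (Suc t) \<noteq> i 0" if "t \<le> n" for t
    using i(1) that by (auto dest: inj_onD)
  have iJ: "i t \<in> J" if "t \<le> Suc n" for t using i(2) that by auto
  have eJ: "e s \<notin> J" if "s \<le> n" for s
    using e(2) that by (metis disjoint_iff image_eqI le_imp_less_Suc lessThan_iff)
  have ve: "v \<noteq> e s" if "s \<le> n" for s using v(2) that by auto
  have w00: "f (insert (e 0) (J - {i 0})) = 1" using w[of 0 0] by simp
  show ?case
  proof (cases "n = 0")
    case True
    have "degenerate_three_term (f J * f (insert v (insert (e 0) (J - {i 0}) - {i 1})))
     (f (insert (e 0) (J - {i 0})) * f (insert v (J - {i 1})))
     (f (insert v (J - {i 0})) * f (insert (e 0) (J - {i 1})))"
      using iJ[of 0] iJ[of 1] ne[of 0] eJ[of 0] v ve[of 0] by (intro pivot) auto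
    then show ?thesis using w[of 1 0] w00 v0 vn True by (auto simp: degenerate_three_term_def)
  next
    case False
    let ?J = "insert (e 0) (J - {i 0})"
    have step: "degenerate_three_term (f (insert x (?J - {i (Suc t)}))) (f (insert x (J - {i (Suc t)})))
        (f (insert x (J - {i 0})) * f (insert (e 0) (J - {i (Suc t)})))"
      if "t \<le> n" "x \<notin> J" "x \<noteq> e 0" for t x
      using pivot[of "i 0" J "i (Suc t)" "e 0" x] iJ[of 0] iJ[of "Suc t"] ne[of t] eJ[of 0] that J w00
      by auto
    \<comment> \<open>In the new basis \<open>?J\<close> the shorter path has the old weights (\<open>old\<close>, \<open>vfar\<close>),
      and \<open>v\<close> inherits at \<open>i 1\<close> the weight that it had at \<open>i 0\<close> (\<open>vnear\<close>).\<close>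
    have old: "f (insert (e (Suc s)) (?J - {i (Suc t)})) = f (insert (e (Suc s)) (J - {i (Suc t)}))"
      if "t \<le> n" "s < n" for t s
    proof -
      have "e (Suc s) \<noteq> e 0" using e(1) that by (auto dest: inj_onD)
      then show ?thesis using step[of t "e (Suc s)"] eJ[of "Suc s"] w[of 0 "Suc s"] that
        by (auto simp: degenerate_three_term_def)
    qed
    have vfar: "f (insert v (?J - {i (Suc t)})) = f (insert v (J - {i (Suc t)}))"
      if "t \<le> n" "t > 0" for t
      using step[of t v] v ve[of 0] w[of "Suc t" 0] that by (auto simp: degenerate_three_term_def)
    have vnear: "f (insert v (?J - {i (Suc 0)})) = f (insert v (J - {i 0}))"
      using step[of 0 v] v ve[of 0] w[of "Suc 0" 0] vt[of 1] False v0 by (auto simp: degenerate_three_term_def)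
    have "f (insert v (?J - {(i \<circ> Suc) 0})) = f (insert v (?J - {(i \<circ> Suc) n}))"
    proof (rule Suc.IH[where e = "e \<circ> Suc"])
      show "f ?J = 1" by (rule w00)
      show "inj_on (i \<circ> Suc) {..n}" using i(1) by (auto simp: inj_on_def)
      show "(i \<circ> Suc) ` {..n} \<subseteq> ?J" using iJ ne by auto
      show "inj_on (e \<circ> Suc) {..<n}" using e(1) by (auto simp: inj_on_def)
      show "(e \<circ> Suc) ` {..<n} \<inter> ?J = {}" using eJ e(1) by (auto dest: inj_onD)
      show "v \<notin> ?J" using v ve by auto
      show "v \<notin> (e \<circ> Suc) ` {..<n}" using ve by (metis Suc_leI comp_apply imageE lessThan_iff)
      show "n > 0" using False by simp
      show "f (insert ((e \<circ> Suc) s) (?J - {(i \<circ> Suc) t})) = (if t = s \<or> t = Suc s then 1 else 0)"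
        if "t \<le> n" "s < n" for t s
        using old[OF that] w[of "Suc t" "Suc s"] that by simp
      show "f (insert v (?J - {(i \<circ> Suc) 0})) \<noteq> 0" using vnear v0 by simp
      show "f (insert v (?J - {(i \<circ> Suc) n})) \<noteq> 0" using vfar[of n] vn False by simp
      show "f (insert v (?J - {(i \<circ> Suc) t})) = 0" if "0 < t" "t < n" for t
        using vfar[of t] vt[of "Suc t"] that by simp
    qed
    then show ?thesis using vnear vfar[of n] False by simp
  qed
qed

text \<open>
  Two rows joined by a walk through columns of weight \<open>0\<close> or \<open>1\<close> see the same weight in a new column \<open>v\<close>.
  A shortest walk between two rows that violate this is an induced path on which \<open>v\<close> vanishes in
  between, since a chord or an intermediate nonzero weight would give a shorter violation; so
  \<open>chordless_path\<close> applies.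
\<close>

lemma linked_rows_agree:
  assumes J: "f J = 1" and A: "A \<inter> J = {}" and v: "v \<notin> J" "v \<notin> A"
    and norm: "\<And>i e. i \<in> J \<Longrightarrow> e \<in> A \<Longrightarrow> f (insert e (J - {i})) \<in> {0, 1}"
    and R: "R = {(i, j). i \<in> J \<and> j \<in> J \<and> (\<exists>e\<in>A. f (insert e (J - {i})) \<noteq> 0 \<and> f (insert e (J - {j})) \<noteq> 0)}"
    and ij: "(i, j) \<in> R\<^sup>*" "f (insert v (J - {i})) \<noteq> 0" "f (insert v (J - {j})) \<noteq> 0"
  shows "f (insert v (J - {i})) = f (insert v (J - {j}))"
proof -
  let ?v = "\<lambda>i. f (insert v (J - {i}))"
  have "(i, j) \<in> R ^^ n \<Longrightarrow> ?v i \<noteq> 0 \<Longrightarrow> ?v j \<noteq> 0 \<Longrightarrow> ?v i = ?v j" for n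
  proof (induction n arbitrary: i j rule: less_induct)
    case (less n)
    show ?case
    proof (rule ccontr)
      assume neq: "?v i \<noteq> ?v j"
      from less.prems(1) obtain p where p: "p 0 = i" "p n = j" "\<And>t. t < n \<Longrightarrow> (p t, p (Suc t)) \<in> R"
        by (auto simp: relpow_fun_conv)
      have "n > 0" using p neq by (cases n) auto
      have sub: "(p a, p b) \<in> R ^^ (b - a)" if "a \<le> b" "b \<le> n" for a b
        unfolding relpow_fun_conv using that p(3) by (intro exI[of _ "\<lambda>t. p (a + t)"]) auto
      \<comment> \<open>Minimality: no shorter walk joins the two ends.\<close>
      have short: "\<not> (p 0, p n) \<in> R ^^ m" if "m < n" for m
        using less.IH[OF that, of i j] less.prems neq p(1,2) by auto
      from p(3) have "\<forall>t\<in>{..<n}. \<exists>e\<in>A. f (insert e (J - {p t})) \<noteq> 0 \<and> f (insert e (J - {p (Suc t)})) \<noteq> 0"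
        unfolding R by auto
      then obtain e where e: "\<And>t. t < n \<Longrightarrow> e t \<in> A" "\<And>t. t < n \<Longrightarrow> f (insert (e t) (J - {p t})) \<noteq> 0"
        "\<And>t. t < n \<Longrightarrow> f (insert (e t) (J - {p (Suc t)})) \<noteq> 0"
        by (metis lessThan_iff)
      have pJ: "p t \<in> J" if "t \<le> n" for t
        using that p(3)[of t] p(3)[of "t - 1"] \<open>n > 0\<close> unfolding R by (cases "t < n") auto
      have jump: False if "a < b" "b \<le> n" "(p a, p b) \<in> R ^^ k" "k < b - a" for a b k
      proof -
        have "(p 0, p n) \<in> R ^^ (a + k + (n - b))"
          unfolding relpow_add using sub[of 0 a] sub[of b n] that by auto
        with short[of "a + k + (n - b)"] that show False by simp
      qed
      have link: "(p a, p b) \<in> R" if "a \<le> n" "b \<le> n" "s < n"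
        "f (insert (e s) (J - {p a})) \<noteq> 0" "f (insert (e s) (J - {p b})) \<noteq> 0" for a b s
        using that pJ e(1)[of s] unfolding R by auto
      have chord: "t = s \<or> t = Suc s" if "t \<le> n" "s < n" "f (insert (e s) (J - {p t})) \<noteq> 0" for t s
      proof (rule ccontr)
        assume "\<not> ?thesis"
        then consider "t < s" | "t > Suc s" by linarith
        then show False
        proof cases
          case 1
          then have "1 < Suc s - t" by linarith
          then show False using 1 link[of t "Suc s" s] jump[of t "Suc s" 1] e(3)[of s] that by auto
        next
          case 2
          then have "1 < t - s" by linarith
          then show False using 2 link[of s t s] jump[of s t 1] e(2)[of s] that by auto
        qed
      qed
      have inj: "inj_on p {..n}"
      proof (rule linorder_inj_onI)
        fix a b assume "a < b" "a \<in> {..n}" "b \<in> {..n}"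
        then show "p a \<noteq> p b" using jump[of a b 0] by auto
      qed auto
      have w: "f (insert (e s) (J - {p t})) = (if t = s \<or> t = Suc s then 1 else 0)" if "t \<le> n" "s < n" for t s
        using chord[OF that] norm[OF pJ[OF that(1)] e(1)[OF that(2)]] e(2,3)[OF that(2)] by auto
      have mid: "?v (p t) = 0" if "0 < t" "t < n" for t
      proof (rule ccontr)
        assume "?v (p t) \<noteq> 0"
        then have "?v (p 0) = ?v (p t)" "?v (p t) = ?v (p n)"
          using less.IH[of t "p 0" "p t"] less.IH[of "n - t" "p t" "p n"] sub[of 0 t] sub[of t n]
            that less.prems p(1,2) by auto
        then show False using neq p by simp
      qed
      have einj: "inj_on e {..<n}"
      proof (rule linorder_inj_onI)
        fix a b assume "a < b" "a \<in> {..<n}" "b \<in> {..<n}"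
        then show "e a \<noteq> e b" using w[of a a] w[of a b] by auto
      qed auto
      have "?v (p 0) = ?v (p n)"
      proof (rule chordless_path[of J p n e v])
        show "p ` {..n} \<subseteq> J" using pJ by auto
        show "e ` {..<n} \<inter> J = {}" "v \<notin> e ` {..<n}" using e(1) A v by auto
      qed (use J inj einj v w mid \<open>n > 0\<close> less.prems p(1,2) in auto)
      then show False using neq p by simp
    qed
  qed
  then show ?thesis using ij by (meson rtrancl_imp_relpow)
qed

text \<open>
  By \<open>linked_rows_agree\<close> the weight in column \<open>v\<close> depends only on the connected component of the row.
  Giving each component this common weight as potential normalises column \<open>v\<close> and
  keeps the normalised columns, as each of these lies within one component.
\<close>

lemma scale_new_column:
  assumes J: "f J = 1" and A: "A \<inter> J = {}" and v: "v \<notin> J" "v \<notin> A"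
    and norm: "\<And>i e. i \<in> J \<Longrightarrow> e \<in> A \<Longrightarrow> f (insert e (J - {i})) \<in> {0, 1}"
  obtains k :: "'b \<Rightarrow> 'a" where "\<And>x. k x > 0"
    "\<And>i e. i \<in> J \<Longrightarrow> e \<in> insert v A \<Longrightarrow> f (insert e (J - {i})) \<noteq> 0 \<Longrightarrow>
       f (insert e (J - {i})) * k e = k i"
proof -
  define R where "R = {(i, j). i \<in> J \<and> j \<in> J \<and> (\<exists>e\<in>A. f (insert e (J - {i})) \<noteq> 0 \<and> f (insert e (J - {j})) \<noteq> 0)}"
  let ?v = "\<lambda>i. f (insert v (J - {i}))"
  have sym: "sym (R\<^sup>*)" by (rule sym_rtrancl) (auto simp: R_def sym_def)
  have agree: "?v i = ?v j" if "(i, j) \<in> R\<^sup>*" "?v i \<noteq> 0" "?v j \<noteq> 0" for i j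
    using linked_rows_agree[OF J A v norm R_def that] by blast
  define r where "r i = (if \<exists>j. (i, j) \<in> R\<^sup>* \<and> ?v j \<noteq> 0 then ?v (SOME j. (i, j) \<in> R\<^sup>* \<and> ?v j \<noteq> 0) else 1)" for i
  have r: "r i = ?v j" if "(i, j) \<in> R\<^sup>*" "?v j \<noteq> 0" for i j
  proof -
    define m where "m = (SOME j. (i, j) \<in> R\<^sup>* \<and> ?v j \<noteq> 0)"
    have m: "(i, m) \<in> R\<^sup>*" "?v m \<noteq> 0"
      using someI[of "\<lambda>j. (i, j) \<in> R\<^sup>* \<and> ?v j \<noteq> 0", OF conjI[OF that]] unfolding m_def by auto
    have "r i = ?v m" using that unfolding r_def m_def by auto
    also have "(m, j) \<in> R\<^sup>*" using m(1) that(1) sym by (meson rtrancl_trans symD)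
    then have "?v m = ?v j" using agree m(2) that(2) by blast
    finally show ?thesis .
  qed
  have r1: "r i = 1" if "\<not> (\<exists>j. (i, j) \<in> R\<^sup>* \<and> ?v j \<noteq> 0)" for i
    unfolding r_def using that by (simp only: if_False)
  have r_pos: "r i > 0" for i
  proof (cases "\<exists>j. (i, j) \<in> R\<^sup>* \<and> ?v j \<noteq> 0")
    case True
    then obtain j where "(i, j) \<in> R\<^sup>*" "?v j \<noteq> 0" by blast
    then show ?thesis using r nonneg[of "insert v (J - {j})"] by (simp add: order_less_le)
  qed (simp add: r1)
  have r_link: "r i = r j" if "(i, j) \<in> R" for i j
  proof (cases "\<exists>m. (i, m) \<in> R\<^sup>* \<and> ?v m \<noteq> 0")
    case True
    then obtain m where m: "(i, m) \<in> R\<^sup>*" "?v m \<noteq> 0" by blast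
    have "(j, i) \<in> R\<^sup>*" using that sym by (meson r_into_rtrancl symD)
    then show ?thesis using r[OF m] r[of j m] m by (metis rtrancl_trans)
  next
    case False
    then have "\<not> (\<exists>m. (j, m) \<in> R\<^sup>* \<and> ?v m \<noteq> 0)" using that by (meson converse_rtrancl_into_rtrancl)
    then show ?thesis using r1 False by metis
  qed
  define k where "k x = (if x \<in> J then r x
      else if x \<in> A \<and> (\<exists>i\<in>J. f (insert x (J - {i})) \<noteq> 0) then r (SOME i. i \<in> J \<and> f (insert x (J - {i})) \<noteq> 0)
      else 1)" for x
  show thesis
  proof (rule that[of k])
    show "k x > 0" for x unfolding k_def using r_pos by auto
    fix i e assume i: "i \<in> J" and e: "e \<in> insert v A" and nz: "f (insert e (J - {i})) \<noteq> 0"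
    show "f (insert e (J - {i})) * k e = k i"
    proof (cases "e = v")
      case True
      then have "k e = 1" using v by (simp add: k_def)
      then show ?thesis using r[of i i] i nz True by (simp add: k_def)
    next
      case False
      then have eA: "e \<in> A" "e \<notin> J" using e A by auto
      define m where "m = (SOME i. i \<in> J \<and> f (insert e (J - {i})) \<noteq> 0)"
      have m: "m \<in> J" "f (insert e (J - {m})) \<noteq> 0"
        using someI[of "\<lambda>i. i \<in> J \<and> f (insert e (J - {i})) \<noteq> 0", OF conjI[OF i nz]] unfolding m_def by auto
      have "(m, i) \<in> R" using m i nz eA unfolding R_def by auto
      moreover have "k e = r m" using eA i nz unfolding k_def m_def by auto
      ultimately show ?thesis using norm[OF i eA(1)] nz i r_link by (auto simp: k_def)
    qed
  qed
qed

text \<open>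
  The columns are added one at a time; after each one, \<open>f\<close> is rescaled so that the
  neighbours treated so far have value \<open>0\<close> or \<open>1\<close>.
\<close>

lemma neighbour_potentials:
  assumes J: "f J \<noteq> 0" and "finite A" "A \<inter> J = {}"
  shows "\<exists>h::'b \<Rightarrow> 'a. (\<forall>x. h x > 0) \<and> (\<forall>i\<in>J. \<forall>e\<in>A. f (insert e (J - {i})) \<noteq> 0 \<longrightarrow>
     f (insert e (J - {i})) * h e = f J * h i)"
  using assms(2,3)
proof (induction A rule: finite_induct)
  case empty
  then show ?case by (intro exI[of _ "\<lambda>_. 1"]) auto
next
  case (insert v A)
  from insert.prems have "A \<inter> J = {}" by auto
  from insert.IH[OF this] obtain h :: "'b \<Rightarrow> 'a" where h: "\<And>x. h x > 0"
    "\<And>i e. i \<in> J \<Longrightarrow> e \<in> A \<Longrightarrow> f (insert e (J - {i})) \<noteq> 0 \<Longrightarrow> f (insert e (J - {i})) * h e = f J * h i"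
    by auto
  have finJ: "finite J" using support[OF J] finite_ground finite_subset by blast
  define c where "c = 1 / (f J * prod h J)"
  define g where "g I = c * f I * prod h I" for I
  have pJ: "prod h J > 0" "f J > 0" using prod_pos[of J h] h(1) nonneg[of J] J by (auto simp: order_less_le)
  then have c: "c > 0" by (simp add: c_def)
  interpret g: binary_valuation E g
    unfolding g_def using rescale[OF c h(1)] .
  have gJ: "g J = 1" using pJ by (simp add: g_def c_def)
  have gn: "g (insert e (J - {i})) = f (insert e (J - {i})) * h e / (f J * h i)"
    if "i \<in> J" "e \<notin> J" for i e
  proof -
    have "prod h (insert e (J - {i})) = h e * (prod h J / h i)"
      using that finJ h(1)[of i] by (simp add: prod_diff1 less_imp_neq[THEN not_sym])
    then show ?thesis using pJ h(1)[of i] by (simp add: g_def c_def field_simps)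
  qed
  have vJ: "v \<notin> J" "A \<inter> J = {}" using insert.prems by auto
  have norm: "g (insert e (J - {i})) \<in> {0, 1}" if "i \<in> J" "e \<in> A" for i e
  proof -
    have "e \<notin> J" using that vJ by auto
    then show ?thesis using gn[of i e] h(2)[OF that] that h(1)[of i] pJ by fastforce
  qed
  obtain k :: "'b \<Rightarrow> 'a" where k: "\<And>x. k x > 0"
    "\<And>i e. i \<in> J \<Longrightarrow> e \<in> insert v A \<Longrightarrow> g (insert e (J - {i})) \<noteq> 0 \<Longrightarrow>
       g (insert e (J - {i})) * k e = k i"
    using g.scale_new_column[OF gJ vJ(2,1) insert.hyps(2) norm] by blast
  show ?case
  proof (intro exI[of _ "\<lambda>x. h x * k x"] conjI allI ballI impI)
    show "h x * k x > 0" for x using h(1) k(1) by simp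
    fix i e assume i: "i \<in> J" and e: "e \<in> insert v A" and nz: "f (insert e (J - {i})) \<noteq> 0"
    have eJ: "e \<notin> J" using e vJ by auto
    have hi: "h i > 0" "h e > 0" using h(1) by auto
    have "g (insert e (J - {i})) \<noteq> 0" using gn[OF i eJ] nz pJ hi by simp
    then have "f (insert e (J - {i})) * h e / (f J * h i) * k e = k i"
      using k(2)[OF i e] gn[OF i eJ] by simp
    then show "f (insert e (J - {i})) * (h e * k e) = f J * (h i * k i)"
      using pJ hi by (simp add: field_simps)
  qed
qed

text \<open>
  Moving \<open>I\<close> one exchange step towards \<open>J\<close> removes one element from each of the two differences. Their
  common size measures the distance between two bases.
\<close>

lemma card_bases:
  assumes "f I \<noteq> 0" "f J \<noteq> 0" shows "card (I - J) = card (J - I)"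
proof -
  have fin: "finite I" if "f I \<noteq> 0" for I using support[OF that] finite_ground finite_subset by blast
  have le: "card (I - J) \<le> card (J - I)" if "f I \<noteq> 0" "f J \<noteq> 0" for I J
    using that
  proof (induction "card (I - J)" arbitrary: I)
    case 0 then show ?case by simp
  next
    case (Suc n)
    then obtain e where e: "e \<in> I - J" by (metis card.empty ex_in_conv nat.distinct(1))
    from exchange[OF Suc.prems e] obtain i where i: "i \<in> J - I" "f (insert i (I - {e})) \<noteq> 0" by blast
    let ?I = "insert i (I - {e})"
    have eq: "?I - J = (I - J) - {e}" "J - ?I = (J - I) - {i}" using e i by auto
    have "n = card (?I - J)" using Suc.hyps(2) e fin[OF Suc.prems(1)] unfolding eq by simp
    then have "card (?I - J) \<le> card (J - ?I)" using Suc.hyps(1)[of ?I] i Suc.prems by simp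
    then have "n \<le> card (J - I) - 1" using \<open>n = _\<close> eq i fin[OF Suc.prems(2)] by simp
    moreover have "card (J - I) > 0" using i fin[OF Suc.prems(2)] by (auto simp: card_gt_0_iff)
    ultimately show ?case using Suc.hyps(2) by simp
  qed
  show ?thesis using le assms by (simp add: le_antisym)
qed

text \<open>
  A basis \<open>I\<close> at distance at least two from \<open>J\<close> can be moved towards \<open>J\<close> twice by exchange. In the
  three-term relation spanned by these two moves every set except \<open>I\<close> is closer to \<open>J\<close>, and the
  product that contains \<open>f I\<close> is nonzero, hence equal to one of the others.
\<close>

lemma neighbours_determine:
  assumes J: "f J = 1" and nb: "\<And>i e. i \<in> J \<Longrightarrow> e \<notin> J \<Longrightarrow> f (insert e (J - {i})) \<in> {0, 1}"
  shows "f I \<in> {0, 1}"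
proof (induction "card (I - J)" arbitrary: I rule: less_induct)
  case less
  show ?case
  proof (cases "f I = 0")
    case nz: False
    have J0: "f J \<noteq> 0" using J by simp
    have fin: "finite I" "finite J" using support[OF nz] support[OF J0] finite_ground finite_subset by blast+
    note cd = card_bases[OF nz J0]
    consider "card (I - J) = 0" | "card (I - J) = 1" | "card (I - J) \<ge> 2" by linarith
    then show ?thesis
    proof cases
      case 1
      then have "I - J = {}" "J - I = {}" using cd fin by (metis card_0_eq finite_Diff)+
      then have "I = J" by blast
      then show ?thesis using J by simp
    next
      case 2
      then obtain e i where ei: "I - J = {e}" "J - I = {i}" using cd by (metis card_1_singletonE)
      then have "I = insert e (J - {i})" "i \<in> J" "e \<notin> J" by blast+
      then show ?thesis using nb by simp
    next
      case 3
      then obtain e where e: "e \<in> I - J" by (metis card.empty ex_in_conv not_numeral_le_zero)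
      from exchange[OF nz J0 e] obtain i where i: "i \<in> J - I" "f (insert i (I - {e})) \<noteq> 0" by blast
      let ?I = "insert i (I - {e})"
      have "?I - J = (I - J) - {e}" using i e by auto
      then have "card (?I - J) \<ge> 1" using 3 e fin by simp
      then obtain e' where e': "e' \<in> ?I - J" by (metis One_nat_def card.empty ex_in_conv not_less_eq_eq zero_le)
      from exchange[OF i(2) J0 e'] obtain i' where i': "i' \<in> J - ?I" "f (insert i' (?I - {e'})) \<noteq> 0" by blast
      define S where "S = I - {e, e'}"
      have d: "e' \<noteq> e" "e' \<in> I" "i \<noteq> i'" "i' \<notin> I" using e e' i i' by auto
      have degenerate_three_term: "degenerate_three_term (f (insert e (insert e' S)) * f (insert i (insert i' S)))
             (f (insert e (insert i S)) * f (insert e' (insert i' S)))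
             (f (insert e (insert i' S)) * f (insert e' (insert i S)))"
        using d e e' i i' by (intro three_term) (auto simp: S_def)
      have smaller: "f (insert x (insert y S)) \<in> {0, 1}" if "y \<in> J" "x \<in> {e, e'} \<union> J" for x y
      proof (rule less.hyps, rule psubset_card_mono)
        show "finite (I - J)" using fin by simp
        have "insert x (insert y S) - J \<subseteq> I - J" using that d e by (auto simp: S_def)
        moreover have "\<exists>z\<in>{e, e'}. z \<noteq> x \<and> z \<noteq> y" using d that e e' by auto
        then have "\<exists>z\<in>I - J. z \<notin> insert x (insert y S)" using d e e' by (auto simp: S_def)
        ultimately show "insert x (insert y S) - J \<subset> I - J" by blast
      qed
      have I: "insert e (insert e' S) = I" using e d by (auto simp: S_def)
      have "insert i (insert i' S) = insert i' (?I - {e'})" using d e' i by (auto simp: S_def)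
      then have nz': "f (insert i (insert i' S)) \<noteq> 0" using i' by simp
      have J': "i \<in> J" "i' \<in> J" using i i' by auto
      have "f (insert i (insert i' S)) = 1" using smaller[of i' i] nz' J' by simp
      moreover have "f (insert e (insert i S)) \<in> {0, 1}" "f (insert e (insert i' S)) \<in> {0, 1}"
        "f (insert e' (insert i S)) \<in> {0, 1}" "f (insert e' (insert i' S)) \<in> {0, 1}"
        using smaller J' by simp_all
      ultimately show ?thesis using degenerate_three_term nz unfolding I by (auto simp: degenerate_three_term_def)
    qed
  qed simp
qed

text \<open>
  On bases, \<open>f\<close> is a product of weights of the elements, up to a constant.
\<close>

theorem rescale_to_unit:
  obtains c :: 'a and h :: "'b \<Rightarrow> 'a" where "c > 0" "\<And>x. h x > 0" "\<And>I. f I \<noteq> 0 \<Longrightarrow> c * f I * prod h I = 1"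
proof (cases "\<exists>J. f J \<noteq> 0")
  case False
  then show thesis using that[of 1 "\<lambda>_. 1"] by auto
next
  case True
  then obtain J where J: "f J \<noteq> 0" by blast
  have finJ: "finite J" using support[OF J] finite_ground finite_subset by blast
  have "finite (E - J)" "(E - J) \<inter> J = {}" using finite_ground by auto
  from neighbour_potentials[OF J this] obtain h :: "'b \<Rightarrow> 'a" where h: "\<And>x. h x > 0"
    "\<And>i e. i \<in> J \<Longrightarrow> e \<in> E - J \<Longrightarrow> f (insert e (J - {i})) \<noteq> 0 \<Longrightarrow> f (insert e (J - {i})) * h e = f J * h i"
    by auto
  define c where "c = 1 / (f J * prod h J)"
  define g where "g I = c * f I * prod h I" for I
  have pos: "prod h I > 0" for I using prod_pos[of I h] h(1) by auto
  have pJ: "prod h J > 0" "f J > 0" using pos nonneg[of J] J by (auto simp: order_less_le)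
  then have c: "c > 0" by (simp add: c_def)
  interpret g: binary_valuation E g
    unfolding g_def using rescale[OF c h(1)] .
  have nb: "g (insert e (J - {i})) \<in> {0, 1}" if i: "i \<in> J" and e: "e \<notin> J" for i e
  proof (cases "f (insert e (J - {i})) = 0")
    case True then show ?thesis by (simp add: g_def)
  next
    case False
    then have "e \<in> E - J" using support[OF False] e by auto
    note eq = h(2)[OF i this False]
    have "prod h (insert e (J - {i})) = h e * (prod h J / h i)"
      using i e finJ h(1)[of i] by (simp add: prod_diff1 less_imp_neq[THEN not_sym])
    then have "g (insert e (J - {i})) = (f (insert e (J - {i})) * h e) * prod h J / (f J * h i * prod h J)"
      by (simp add: g_def c_def mult_ac)
    then have "g (insert e (J - {i})) = 1" unfolding eq using pJ h(1)[of i] by simp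
    then show ?thesis by simp
  qed
  have "g J = 1" using pJ by (simp add: g_def c_def)
  from g.neighbours_determine[OF this nb] have "g I \<in> {0, 1}" for I by blast
  moreover have "g I \<noteq> 0" if "f I \<noteq> 0" for I using that c pos[of I] by (simp add: g_def)
  ultimately show thesis using that[of c h] c h(1) unfolding g_def by blast
qed

end

section \<open>Minors with arbitrary row and column lists\<close>

text \<open>
  Row and column indices are given as functions, in any order and possibly with repetitions: exchange
  arguments replace single indices, and repetitions give the value \<open>0\<close>. Only \<open>\<rho>\<close> and \<open>\<gamma>\<close> on
  \<open>{..<n}\<close> matter.
\<close>

definition minor :: "nat \<Rightarrow> 'a::comm_ring_1 mat \<Rightarrow> (nat \<Rightarrow> nat) \<Rightarrow> (nat \<Rightarrow> nat) \<Rightarrow> 'a" where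
  "minor n A \<rho> \<gamma> = det (mat n n (\<lambda>(i, j). A $$ (\<rho> i, \<gamma> j)))"

lemma minor_cong:
  assumes "\<And>i j. i < n \<Longrightarrow> j < n \<Longrightarrow> A $$ (\<rho> i, \<gamma> j) = B $$ (\<rho>' i, \<gamma>' j)"
  shows "minor n A \<rho> \<gamma> = minor n B \<rho>' \<gamma>'"
  unfolding minor_def using assms by (intro arg_cong[of _ _ det] eq_matI) auto

lemma minor_0 [simp]: "minor 0 A \<rho> \<gamma> = 1"
  by (simp add: minor_def)

lemma minor_repeated_column:
  assumes "a < n" "b < n" "a \<noteq> b" "\<gamma> a = \<gamma> b"
  shows "minor n A \<rho> \<gamma> = 0"
  unfolding minor_def
  by (rule det_identical_columns[of _ n a b]) (use assms in \<open>auto intro!: eq_vecI\<close>)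

lemma minor_repeated_row:
  assumes "a < n" "b < n" "a \<noteq> b" "\<rho> a = \<rho> b"
  shows "minor n A \<rho> \<gamma> = 0"
  unfolding minor_def
  by (rule det_identical_rows[of _ n a b]) (use assms in \<open>auto intro!: eq_vecI\<close>)

lemma minor_nonzero_inj:
  assumes "minor n A \<rho> \<gamma> \<noteq> 0"
  shows "inj_on \<rho> {..<n}" "inj_on \<gamma> {..<n}"
  using assms minor_repeated_row[of _ n _ \<rho> A \<gamma>] minor_repeated_column[of _ n _ \<gamma> A \<rho>]
  unfolding inj_on_def by (meson lessThan_iff)+

lemma signof_cases: "signof p = (1 :: 'a::comm_ring_1) \<or> signof p = (-1 :: 'a)"
  unfolding sign_def by (auto simp: of_int_def)

lemma same_image_permutes:
  assumes "inj_on g {..<n}" "inj_on g' {..<n}" "g ` {..<n} = g' ` {..<n}"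
  obtains p where "p permutes {0..<n::nat}" "\<And>j. j < n \<Longrightarrow> g j = g' (p j)"
proof -
  define p where "p j = (if j < n then inv_into {..<n} g' (g j) else j)" for j
  have gp: "g j = g' (p j) \<and> p j < n" if "j < n" for j
  proof -
    have "g j \<in> g' ` {..<n}" using that assms(3) by blast
    then show ?thesis using that f_inv_into_f[of "g j" g' "{..<n}"] inv_into_into[of "g j" g' "{..<n}"]
      by (simp add: p_def)
  qed
  have "inj_on p {0..<n}"
    using gp assms(1) by (metis atLeastLessThan_iff inj_onD inj_onI lessThan_iff)
  moreover have "p ` {0..<n} \<subseteq> {0..<n}" using gp by auto
  ultimately have "bij_betw p {0..<n} {0..<n}"
    by (simp add: bij_betw_def endo_inj_surj)
  then have "p permutes {0..<n}" by (rule bij_imp_permutes) (auto simp: p_def)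
  then show thesis using that gp by blast
qed

lemma minor_same_rows:
  assumes "inj_on \<rho> {..<n}" "inj_on \<rho>' {..<n}" "\<rho> ` {..<n} = \<rho>' ` {..<n}"
  shows "minor n A \<rho> \<gamma> = minor n A \<rho>' \<gamma> \<or> minor n A \<rho> \<gamma> = - minor n A \<rho>' \<gamma>"
proof -
  obtain p where p: "p permutes {0..<n}" "\<And>j. j < n \<Longrightarrow> \<rho> j = \<rho>' (p j)"
    using same_image_permutes[OF assms] by metis
  let ?M = "mat n n (\<lambda>(i, j). A $$ (\<rho>' i, \<gamma> j))"
  have "mat n n (\<lambda>(i, j). A $$ (\<rho> i, \<gamma> j)) = mat n n (\<lambda>(i, j). ?M $$ (p i, j))"
    using p permutes_in_image[OF p(1)] by (intro eq_matI) auto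
  then have "minor n A \<rho> \<gamma> = signof p * minor n A \<rho>' \<gamma>"
    unfolding minor_def using det_permute_rows[OF _ p(1), of ?M] by simp
  then show ?thesis using signof_cases[of p, where 'a = 'a] by auto
qed

lemma minor_same_columns:
  assumes "inj_on \<gamma> {..<n}" "inj_on \<gamma>' {..<n}" "\<gamma> ` {..<n} = \<gamma>' ` {..<n}"
  shows "minor n A \<rho> \<gamma> = minor n A \<rho> \<gamma>' \<or> minor n A \<rho> \<gamma> = - minor n A \<rho> \<gamma>'"
proof -
  obtain p where p: "p permutes {0..<n}" "\<And>j. j < n \<Longrightarrow> \<gamma> j = \<gamma>' (p j)"
    using same_image_permutes[OF assms] by metis
  let ?M = "mat n n (\<lambda>(i, j). A $$ (\<rho> j, \<gamma>' i))"
  have "transpose_mat (mat n n (\<lambda>(i, j). A $$ (\<rho> i, \<gamma> j))) = mat n n (\<lambda>(i, j). ?M $$ (p i, j))"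
    using p permutes_in_image[OF p(1)] by (intro eq_matI) auto
  moreover have "transpose_mat (mat n n (\<lambda>(i, j). A $$ (\<rho> i, \<gamma>' j))) = ?M"
    by (intro eq_matI) auto
  ultimately have "minor n A \<rho> \<gamma> = signof p * minor n A \<rho> \<gamma>'"
    unfolding minor_def using det_permute_rows[OF _ p(1), of ?M]
    by (metis det_transpose mat_carrier)
  then show ?thesis using signof_cases[of p, where 'a = 'a] by auto
qed

lemma minor_scale:
  "minor n (mat r c (\<lambda>(i, j). b i * A $$ (i, j) * a j)) \<rho> \<gamma> =
     (\<Prod>i<n. b (\<rho> i)) * (\<Prod>j<n. a (\<gamma> j)) * minor n A \<rho> \<gamma>"
  if "\<And>i. i < n \<Longrightarrow> \<rho> i < r" "\<And>j. j < n \<Longrightarrow> \<gamma> j < c"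
proof -
  have "(\<Prod>i = 0..<n. b (\<rho> i) * A $$ (\<rho> i, \<gamma> (p i)) * a (\<gamma> (p i))) =
      (\<Prod>i<n. b (\<rho> i)) * (\<Prod>j<n. a (\<gamma> j)) * (\<Prod>i = 0..<n. A $$ (\<rho> i, \<gamma> (p i)))"
    if p: "p permutes {0..<n}" for p
    using prod.permute[OF p, of "\<lambda>j. a (\<gamma> j)"]
    by (simp add: prod.distrib atLeast0LessThan comp_def mult_ac)
  moreover have "p i < n" if "p permutes {0..<n}" "i < n" for p i
    using permutes_in_image[OF that(1), of i] that(2) by simp
  ultimately show ?thesis
    unfolding minor_def using that
    by (subst (1 2) det_def'[of _ n]) (simp_all add: sum_distrib_left mult_ac)
qed

lemma minor_mult:
  assumes W: "W \<in> carrier_mat r n" and V: "V \<in> carrier_mat n c"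
    and "\<And>i. i < n \<Longrightarrow> \<rho> i < r" "\<And>j. j < n \<Longrightarrow> \<gamma> j < c"
  shows "minor n (W * V) \<rho> \<gamma> = minor n W \<rho> id * minor n V id \<gamma>"
proof -
  have "mat n n (\<lambda>(i, j). (W * V) $$ (\<rho> i, \<gamma> j)) =
      mat n n (\<lambda>(i, j). W $$ (\<rho> i, id j)) * mat n n (\<lambda>(i, j). V $$ (id i, \<gamma> j))"
    using assms by (intro eq_matI) (auto simp: scalar_prod_def)
  then show ?thesis unfolding minor_def by (simp add: det_mult[of _ n])
qed

lemma bij_betw_pick:
  assumes "finite I" "card I = n" shows "bij_betw (pick I) {..<n} I"
proof -
  have "inj_on (pick I) {..<n}"
    using assms by (intro linorder_inj_onI) (auto dest: pick_mono_le[rotated])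
  moreover have "pick I ` {..<n} \<subseteq> I" using assms by (auto intro: pick_in_set_le)
  ultimately show ?thesis
    unfolding bij_betw_def using assms by (simp add: card_image card_subset_eq)
qed

lemma det_submatrix:
  assumes "I \<subseteq> {..<dim_row A}" "J \<subseteq> {..<dim_col A}" "card I = n" "card J = n"
  shows "det (submatrix A I J) = minor n A (pick I) (pick J)"
proof -
  have "{i. i < dim_row A \<and> i \<in> I} = I" "{j. j < dim_col A \<and> j \<in> J} = J" using assms by auto
  then show ?thesis unfolding submatrix_def minor_def using assms by simp
qed

lemma maximal_minor_eq:
  assumes "X \<in> carrier_mat d N" "I \<subseteq> {..<N}" "card I = d"
  shows "maximal_minor X I = minor d X id (pick I)"
proof -
  have "{i. i < dim_row X \<and> i \<in> UNIV} = {..<d}" "{j. j < dim_col X \<and> j \<in> I} = I" using assms by auto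
  then show ?thesis unfolding maximal_minor_def submatrix_def minor_def using assms by (simp add: pick_UNIV)
qed

text \<open>
  Grassmann-Pluecker relation: with \<open>B\<close> and \<open>D\<close> the submatrices for \<open>\<beta>\<close> and \<open>\<delta>\<close>, the identity
  \<open>B adj(B) = det(B) 1\<close> expresses \<open>det(B)\<close> times column \<open>k\<close> of \<open>D\<close> as a combination of the columns of \<open>B\<close>,
  with coefficients given by replacing columns of \<open>B\<close>; inserting this into \<open>det(D)\<close>,
  which is linear in its column \<open>k\<close>, gives the sum.
\<close>

lemma pluecker_exchange:
  assumes k: "k < n"
  shows "minor n A \<rho> \<beta> * minor n A \<rho> \<delta> =
    (\<Sum>j<n. minor n A \<rho> (\<beta>(j := \<delta> k)) * minor n A \<rho> (\<delta>(k := \<beta> j)))"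
proof -
  let ?M = "\<lambda>\<gamma>. mat n n (\<lambda>(i, j). A $$ (\<rho> i, \<gamma> j))"
  have expand: "minor n A \<rho> (\<gamma>(j := x)) = (\<Sum>i<n. A $$ (\<rho> i, x) * cofactor (?M \<gamma>) i j)"
    if "j < n" for \<gamma> j x
  proof -
    have "mat_delete (?M (\<gamma>(j := x))) i j = mat_delete (?M \<gamma>) i j" if "i < n" for i
      using \<open>j < n\<close> that by (intro eq_matI) (auto simp: mat_delete_def)
    then show ?thesis
      unfolding minor_def using that
      by (subst laplace_expansion_column[of _ n j]) (auto simp: cofactor_def intro!: sum.cong)
  qed
  \<comment> \<open>The entries of \<open>B adj(B)\<close>.\<close>
  have adj: "(\<Sum>j<n. A $$ (\<rho> r, \<beta> j) * cofactor (?M \<beta>) s j) = (if r = s then minor n A \<rho> \<beta> else 0)"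
    if "r < n" "s < n" for r s
  proof -
    have "(?M \<beta> * adj_mat (?M \<beta>)) $$ (r, s) = (minor n A \<rho> \<beta> \<cdot>\<^sub>m 1\<^sub>m n) $$ (r, s)"
      using adj_mat(2)[of "?M \<beta>" n] by (simp add: minor_def)
    moreover have "(?M \<beta> * adj_mat (?M \<beta>)) $$ (r, s) = (\<Sum>j<n. A $$ (\<rho> r, \<beta> j) * cofactor (?M \<beta>) s j)"
      using that adj_mat(1)[of "?M \<beta>" n]
      by (subst index_mult_mat) (auto simp: scalar_prod_def adj_mat_def atLeast0LessThan intro!: sum.cong)
    ultimately show ?thesis using that by simp
  qed
  have "(\<Sum>j<n. minor n A \<rho> (\<beta>(j := \<delta> k)) * minor n A \<rho> (\<delta>(k := \<beta> j))) =
    (\<Sum>j<n. (\<Sum>s<n. A $$ (\<rho> s, \<delta> k) * cofactor (?M \<beta>) s j) * (\<Sum>r<n. A $$ (\<rho> r, \<beta> j) * cofactor (?M \<delta>) r k))"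
    using k by (simp add: expand)
  also have "\<dots> = (\<Sum>j<n. \<Sum>s<n. \<Sum>r<n. A $$ (\<rho> s, \<delta> k) * cofactor (?M \<delta>) r k * (A $$ (\<rho> r, \<beta> j) * cofactor (?M \<beta>) s j))"
    unfolding sum_product by (intro sum.cong refl) (simp add: mult_ac)
  also have "\<dots> = (\<Sum>s<n. \<Sum>r<n. \<Sum>j<n. A $$ (\<rho> s, \<delta> k) * cofactor (?M \<delta>) r k * (A $$ (\<rho> r, \<beta> j) * cofactor (?M \<beta>) s j))"
    by (subst sum.swap, rule sum.cong[OF refl], rule sum.swap)
  also have "\<dots> = (\<Sum>s<n. \<Sum>r<n. A $$ (\<rho> s, \<delta> k) * cofactor (?M \<delta>) r k * (if r = s then minor n A \<rho> \<beta> else 0))"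
    by (simp add: adj flip: sum_distrib_left)
  also have "\<dots> = (\<Sum>s<n. A $$ (\<rho> s, \<delta> k) * cofactor (?M \<delta>) s k * minor n A \<rho> \<beta>)"
    by (intro sum.cong refl) (simp add: if_distrib sum.delta' cong: if_cong)
  also have "\<dots> = minor n A \<rho> \<beta> * (\<Sum>s<n. A $$ (\<rho> s, \<delta> k) * cofactor (?M \<delta>) s k)"
    by (simp add: sum_distrib_left mult_ac)
  also have "\<dots> = minor n A \<rho> \<beta> * minor n A \<rho> \<delta>"
    using expand[OF k, of \<delta> "\<delta> k"] by simp
  finally show ?thesis by simp
qed

section \<open>Rank and factorisations\<close>

text \<open>
  If no row and column enlarge the nonzero minor to a larger nonzero one, then all rows are combinations of
  the chosen ones: expanding the bordered minor along its last column is a linear relation between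
  row \<open>i\<close> and the chosen rows whose coefficients are the same in every column \<open>j\<close>.
\<close>

lemma factor_through_rows:
  fixes A :: "'a::field mat"
  assumes A: "A \<in> carrier_mat r c" and nz: "minor n A \<rho> \<gamma> \<noteq> 0"
    and rows: "\<And>i. i < n \<Longrightarrow> \<rho> i < r"
    and zero: "\<And>i j. i < r \<Longrightarrow> j < c \<Longrightarrow> minor (Suc n) A (\<rho>(n := i)) (\<gamma>(n := j)) = 0"
  obtains W where "W \<in> carrier_mat r n" "A = W * mat n c (\<lambda>(i, j). A $$ (\<rho> i, j))"
proof -
  let ?M = "\<lambda>i j. mat (Suc n) (Suc n) (\<lambda>(s, t). A $$ ((\<rho>(n := i)) s, (\<gamma>(n := j)) t))"
  define W where "W = mat r n (\<lambda>(i, s). - cofactor (?M i 0) s n / minor n A \<rho> \<gamma>)"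
  have A_entry: "A $$ (i, j) = (\<Sum>s<n. W $$ (i, s) * A $$ (\<rho> s, j))" if "i < r" "j < c" for i j
  proof -
    \<comment> \<open>The cofactors along the last column do not see that column, so the index \<open>j\<close> does not matter.\<close>
    have cof: "cofactor (?M i j) s n = cofactor (?M i 0) s n" for s
      unfolding cofactor_def mat_delete_def by (auto intro!: arg_cong[of _ _ det] eq_matI)
    have last: "cofactor (?M i j) n n = minor n A \<rho> \<gamma>"
      unfolding cofactor_def mat_delete_def minor_def by (auto intro!: arg_cong[of _ _ det] eq_matI)
    have "0 = (\<Sum>s<Suc n. ?M i j $$ (s, n) * cofactor (?M i j) s n)"
      using zero[OF that] unfolding minor_def by (subst (asm) laplace_expansion_column[of _ "Suc n" n]) auto
    also have "\<dots> = (\<Sum>s<n. A $$ (\<rho> s, j) * cofactor (?M i 0) s n) + A $$ (i, j) * minor n A \<rho> \<gamma>"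
      using cof last by simp
    finally have "A $$ (i, j) * minor n A \<rho> \<gamma> = - (\<Sum>s<n. A $$ (\<rho> s, j) * cofactor (?M i 0) s n)"
      by (simp add: eq_neg_iff_add_eq_0 add.commute)
    then have "A $$ (i, j) = - (\<Sum>s<n. A $$ (\<rho> s, j) * cofactor (?M i 0) s n) / minor n A \<rho> \<gamma>"
      using nz nonzero_eq_divide_eq by blast
    also have "\<dots> = (\<Sum>s<n. W $$ (i, s) * A $$ (\<rho> s, j))"
      using that by (simp add: W_def sum_negf sum_divide_distrib[symmetric] mult.commute)
    finally show ?thesis .
  qed
  show thesis
  proof (rule that[of W])
    show "W \<in> carrier_mat r n" by (simp add: W_def)
    then show "A = W * mat n c (\<lambda>(i, j). A $$ (\<rho> i, j))"
      using A A_entry by (intro eq_matI) (auto simp: scalar_prod_def atLeast0LessThan)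
  qed
qed

lemma rank_ge_if_minor:
  fixes A :: "'a::field mat"
  assumes A: "A \<in> carrier_mat r c" and nz: "minor n A \<rho> \<gamma> \<noteq> 0"
    and "\<rho> ` {..<n} \<subseteq> {..<r}" "\<gamma> ` {..<n} \<subseteq> {..<c}"
  shows "n \<le> vec_space.rank r A"
proof -
  let ?I = "\<rho> ` {..<n}" and ?J = "\<gamma> ` {..<n}"
  note inj = minor_nonzero_inj[OF nz]
  have card: "card ?I = n" "card ?J = n" using inj by (simp_all add: card_image)
  have pick: "bij_betw (pick ?I) {..<n} ?I" "bij_betw (pick ?J) {..<n} ?J"
    using card by (simp_all add: bij_betw_pick)
  have "minor n A (pick ?I) (pick ?J) \<noteq> 0"
    using minor_same_rows[OF inj(1), of "pick ?I" A \<gamma>] minor_same_columns[OF inj(2), of "pick ?J" A "pick ?I"]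
      pick nz by (auto simp: bij_betw_def)
  then have "det (submatrix A ?I ?J) \<noteq> 0"
    using det_submatrix[of ?I A ?J n] assms card by simp
  then have "card {j. j < c \<and> j \<in> ?J} \<le> vec_space.rank r A"
    by (rule vec_space.rank_gt_minor[OF A])
  moreover have "{j. j < c \<and> j \<in> ?J} = ?J" using assms by auto
  ultimately show ?thesis using card by simp
qed

text \<open>
  The columns of \<open>W * V\<close> lie in the span of the \<open>n\<close> columns of \<open>W\<close>; Steinitz exchange.
\<close>

lemma rank_le_inner_dim:
  fixes W V :: "'a::field mat"
  assumes W: "W \<in> carrier_mat r n" and V: "V \<in> carrier_mat n c"
  shows "vec_space.rank r (W * V) \<le> n"
proof -
  interpret vec_space "TYPE('a)" r .
  let ?A = "W * V"
  have A: "?A \<in> carrier_mat r c" using assms by simp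
  have W_in: "set (cols W) \<subseteq> carrier_vec r" using W cols_dim by blast
  have "lin_indpt {}" by (simp add: lin_dep_def)
  then obtain S where S: "maximal S (\<lambda>T. T \<subseteq> set (cols ?A) \<and> lin_indpt T)"
    using maximal_exists_superset[of "set (cols ?A)" "\<lambda>T. T \<subseteq> set (cols ?A) \<and> lin_indpt T" "{}"] by auto
  then have S': "S \<subseteq> set (cols ?A)" "lin_indpt S" by (auto simp: maximal_def)
  have "set (cols ?A) \<subseteq> span (set (cols W))"
  proof
    fix v assume "v \<in> set (cols ?A)"
    then obtain j where j: "j < c" "v = col ?A j" using A by (auto simp: cols_def)
    then have "v = W *\<^sub>v col V j" using W V by (intro eq_vecI) auto
    then show "v \<in> span (set (cols W))"
      using col_space_eq[OF W] W V j unfolding col_space_def by auto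
  qed
  then have "S \<subseteq> span (set (cols W))" using S' by auto
  moreover have "finite S" using S' finite_subset by blast
  ultimately have "card S \<le> card (set (cols W))"
    using replacement[of S "set (cols W)"] S'(2) W_in by auto
  also have "\<dots> \<le> n" using W card_length[of "cols W"] by simp
  finally show ?thesis using rank_card_indpt[OF A S] by simp
qed

text \<open>
  A largest nonzero minor has size equal to the rank, and its rows carry the whole matrix. All
  comparisons of ranks below, also between different fields, go through this.
\<close>

lemma rank_factorization:
  fixes A :: "'a::field mat"
  assumes A: "A \<in> carrier_mat r c"
  obtains \<rho> \<gamma> W where "\<rho> ` {..<vec_space.rank r A} \<subseteq> {..<r}" "\<gamma> ` {..<vec_space.rank r A} \<subseteq> {..<c}"
    "minor (vec_space.rank r A) A \<rho> \<gamma> \<noteq> 0"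
    "W \<in> carrier_mat r (vec_space.rank r A)"
    "A = W * mat (vec_space.rank r A) c (\<lambda>(i, j). A $$ (\<rho> i, j))"
proof -
  define P where "P n \<longleftrightarrow> (\<exists>\<rho> \<gamma>. \<rho> ` {..<n} \<subseteq> {..<r} \<and> \<gamma> ` {..<n} \<subseteq> {..<c} \<and> minor n A \<rho> \<gamma> \<noteq> 0)" for n
  define n where "n = (GREATEST n. P n)"
  have bound: "n \<le> vec_space.rank r A" if "P n" for n
    using that rank_ge_if_minor[OF A] unfolding P_def by blast
  have "P 0" by (auto simp: P_def)
  then have "P n" unfolding n_def using bound by (rule GreatestI_nat)
  then obtain \<rho> \<gamma> where \<rho>: "\<rho> ` {..<n} \<subseteq> {..<r}" and \<gamma>: "\<gamma> ` {..<n} \<subseteq> {..<c}" and nz: "minor n A \<rho> \<gamma> \<noteq> 0"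
    unfolding P_def by blast
  have zero: "minor (Suc n) A (\<rho>(n := i)) (\<gamma>(n := j)) = 0" if "i < r" "j < c" for i j
  proof (rule ccontr)
    assume "minor (Suc n) A (\<rho>(n := i)) (\<gamma>(n := j)) \<noteq> 0"
    moreover have "\<rho>(n := i) ` {..<Suc n} \<subseteq> {..<r}" "\<gamma>(n := j) ` {..<Suc n} \<subseteq> {..<c}"
      using \<rho> \<gamma> that by (auto simp: less_Suc_eq image_subset_iff)
    ultimately have "P (Suc n)" unfolding P_def by blast
    then have "Suc n \<le> (GREATEST n. P n)" using bound by (rule Greatest_le_nat)
    then show False by (simp add: n_def)
  qed
  obtain W where W: "W \<in> carrier_mat r n" "A = W * mat n c (\<lambda>(i, j). A $$ (\<rho> i, j))"
    using factor_through_rows[OF A nz _ zero] \<rho> by (auto simp: image_subset_iff)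
  have "vec_space.rank r A \<le> n"
    using rank_le_inner_dim[OF W(1), of "mat n c (\<lambda>(i, j). A $$ (\<rho> i, j))" c] W(2) by simp
  then have "vec_space.rank r A = n" using bound[OF \<open>P n\<close>] by simp
  then show thesis using that[of \<rho> \<gamma> W] \<rho> \<gamma> nz W by simp
qed

lemma rank_mult_le:
  fixes A T :: "'a::field mat"
  assumes T: "T \<in> carrier_mat s r" and A: "A \<in> carrier_mat r c"
  shows "vec_space.rank s (T * A) \<le> vec_space.rank r A"
proof -
  let ?k = "vec_space.rank r A"
  obtain \<rho> W where W: "W \<in> carrier_mat r ?k" and eq: "A = W * mat ?k c (\<lambda>(i, j). A $$ (\<rho> i, j))"
    by (rule rank_factorization[OF A])
  let ?V = "mat ?k c (\<lambda>(i, j). A $$ (\<rho> i, j))"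
  have "T * A = T * (W * ?V)" using eq by simp
  also have "\<dots> = (T * W) * ?V"
    using T W by (intro assoc_mult_mat[symmetric, of T s r W ?k ?V c]) auto
  finally show ?thesis using rank_le_inner_dim[of "T * W" s ?k ?V c] T W by simp
qed

section \<open>Absolute values of maximal minors\<close>

lemma maximal_minor_reindex:
  fixes X :: "'a::linordered_field mat"
  assumes X: "X \<in> carrier_mat d N" and g: "bij_betw g {..<d} I" and I: "I \<subseteq> {..<N}"
  shows "\<bar>minor d X id g\<bar> = \<bar>maximal_minor X I\<bar>"
proof -
  have card: "card I = d" "finite I" using bij_betw_same_card[OF g] bij_betw_finite[OF g] by auto
  have "minor d X id g = minor d X id (pick I) \<or> minor d X id g = - minor d X id (pick I)"
    using g bij_betw_pick[OF card(2,1)] by (intro minor_same_columns) (auto simp: bij_betw_def)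
  then show ?thesis using maximal_minor_eq[OF X I card(1)] by auto
qed

text \<open>
  What \<open>\<plusminus>p \<plusminus>q \<plusminus>r = 0\<close> says about absolute values.
\<close>

definition balanced :: "'a::ab_group_add \<Rightarrow> 'a \<Rightarrow> 'a \<Rightarrow> bool" where
  "balanced p q r \<longleftrightarrow> p = q + r \<or> q = p + r \<or> r = p + q"

lemma balanced_abs:
  fixes u v w :: "'a::linordered_field"
  assumes "u = v + w" shows "balanced \<bar>u\<bar> \<bar>v\<bar> \<bar>w\<bar>"
  using assms unfolding balanced_def by linarith

text \<open>
  The exchange relation for two column lists that share \<open>S\<close>: replacing a column of the second
  list by an element of \<open>S\<close> repeats a column, so only two terms survive.
\<close>

lemma three_term_balanced:
  fixes X :: "'a::linordered_field mat"
  assumes X: "X \<in> carrier_mat d N" and S: "S \<subseteq> {..<N}" "Suc (Suc (card S)) = d"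
    and el: "{a, b, c, e} \<subseteq> {..<N} - S" and dist: "distinct [a, b, c, e]"
  defines "F \<equiv> \<lambda>x y. \<bar>maximal_minor X (insert x (insert y S))\<bar>"
  shows "balanced (F a b * F c e) (F a c * F b e) (F a e * F b c)"
proof -
  let ?n = "card S"
  have finS: "finite S" using S finite_subset by blast
  then obtain h where h: "bij_betw h {..<?n} S" using ex_bij_betw_nat_finite[of S] by (auto simp: atLeast0LessThan)
  define g where "g x y = h(?n := x, Suc ?n := y)" for x y
  define D where "D x y = minor d X id (g x y)" for x y
  have hS: "h j \<in> S" if "j < ?n" for j using h that by (auto simp: bij_betw_def)
  have D: "\<bar>D x y\<bar> = F x y" if "x \<in> {..<N} - S" "y \<in> {..<N} - S" "x \<noteq> y" for x y
  proof -
    have "bij_betw (g x y) {..<?n} S" using h by (rule bij_betw_cong[THEN iffD1, rotated]) (simp add: g_def)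
    moreover have "bij_betw (g x y) {?n, Suc ?n} {x, y}" using that by (auto simp: bij_betw_def g_def)
    moreover have "S \<inter> {x, y} = {}" using that by auto
    ultimately have "bij_betw (g x y) ({..<?n} \<union> {?n, Suc ?n}) (S \<union> {x, y})" by (rule bij_betw_combine)
    moreover have "{..<?n} \<union> {?n, Suc ?n} = {..<d}" "S \<union> {x, y} = insert x (insert y S)" using S by auto
    ultimately show ?thesis unfolding D_def F_def
      using maximal_minor_reindex[OF X, of "g x y" "insert x (insert y S)"] that S by auto
  qed
  have F_sym: "F x y = F y x" for x y by (simp add: F_def insert_commute)
  have d: "d = Suc (Suc ?n)" using S by simp
  have upd: "(g a b)(?n := e) = g e b" "(g a b)(Suc ?n := e) = g a e"
    "(g c e)(Suc ?n := x) = g c x" for x by (auto simp: g_def fun_upd_twist)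
  have "D a b * D c e = (\<Sum>j<d. minor d X id ((g a b)(j := g c e (Suc ?n))) *
      minor d X id ((g c e)(Suc ?n := g a b j)))"
    unfolding D_def by (rule pluecker_exchange) (simp add: d)
  also have "\<dots> = (\<Sum>j\<in>{?n, Suc ?n}. minor d X id ((g a b)(j := g c e (Suc ?n))) *
      minor d X id ((g c e)(Suc ?n := g a b j)))"
  proof (rule sum.mono_neutral_right)
    show "\<forall>j\<in>{..<d} - {?n, Suc ?n}. minor d X id ((g a b)(j := g c e (Suc ?n))) *
      minor d X id ((g c e)(Suc ?n := g a b j)) = 0"
    proof
      fix j assume "j \<in> {..<d} - {?n, Suc ?n}"
      then have "j < ?n" using d by auto
      then have "minor d X id ((g c e)(Suc ?n := g a b j)) = 0"
        using d by (intro minor_repeated_column[of j _ "Suc ?n"]) (auto simp: g_def)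
      then show "minor d X id ((g a b)(j := g c e (Suc ?n))) * minor d X id ((g c e)(Suc ?n := g a b j)) = 0"
        by simp
    qed
  qed (auto simp: d)
  also have "\<dots> = D e b * D c a + D a e * D c b"
    unfolding D_def by (simp add: upd) (simp add: g_def fun_upd_twist)
  finally have "balanced \<bar>D a b * D c e\<bar> \<bar>D e b * D c a\<bar> \<bar>D a e * D c b\<bar>" by (rule balanced_abs)
  moreover have "\<bar>D a b * D c e\<bar> = F a b * F c e" "\<bar>D e b * D c a\<bar> = F a c * F b e"
    "\<bar>D a e * D c b\<bar> = F a e * F b c"
    using el dist F_sym by (simp_all add: abs_mult D mult.commute)
  ultimately show ?thesis by simp
qed

text \<open>
  A nonzero product of minors needs a nonzero term in the exchange relation, and that term names the
  exchange.
\<close>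

lemma minor_exchange:
  fixes X :: "'a::linordered_field mat"
  assumes X: "X \<in> carrier_mat d N"
    and I: "I \<subseteq> {..<N}" "card I = d" "maximal_minor X I \<noteq> 0"
    and J: "J \<subseteq> {..<N}" "card J = d" "maximal_minor X J \<noteq> 0"
    and e: "e \<in> I - J"
  shows "\<exists>i\<in>J - I. maximal_minor X (insert i (I - {e})) \<noteq> 0"
proof -
  have fin: "finite I" "finite J" using I J finite_subset by blast+
  note pI = bij_betw_pick[OF fin(1) I(2)] and pJ = bij_betw_pick[OF fin(2) J(2)]
  obtain k where k: "k < d" "pick I k = e" using pI e unfolding bij_betw_def by (metis DiffD1 imageE lessThan_iff)
  have "0 \<noteq> minor d X id (pick J) * minor d X id (pick I)"
    using I J maximal_minor_eq[OF X] by simp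
  also have "minor d X id (pick J) * minor d X id (pick I) =
      (\<Sum>j<d. minor d X id ((pick J)(j := pick I k)) * minor d X id ((pick I)(k := pick J j)))"
    by (rule pluecker_exchange[OF k(1)])
  finally obtain j where j: "j < d" "minor d X id ((pick I)(k := pick J j)) \<noteq> 0"
    by (metis (no_types, lifting) lessThan_iff mult_not_zero sum.neutral)
  have iJ: "pick J j \<in> J" using pJ j(1) by (auto simp: bij_betw_def)
  have "pick J j \<notin> I"
  proof
    assume "pick J j \<in> I"
    then obtain m where "m < d" "pick I m = pick J j"
      using pI unfolding bij_betw_def by (metis imageE lessThan_iff)
    moreover from this have "m \<noteq> k" using iJ k e by auto
    ultimately have "minor d X id ((pick I)(k := pick J j)) = 0"
      using k by (intro minor_repeated_column[of m _ k]) auto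
    then show False using j by simp
  qed
  have "bij_betw ((pick I)(k := pick J j)) {..<d} (insert (pick J j) (I - {e}))"
  proof -
    have "bij_betw (pick I) ({..<d} - {k}) (I - {e})"
      using bij_betw_DiffI[OF pI, of "{k}" "{e}"] k e by (simp add: bij_betw_def)
    then have "bij_betw ((pick I)(k := pick J j)) ({..<d} - {k}) (I - {e})"
      by (rule bij_betw_cong[THEN iffD1, rotated]) auto
    moreover have "bij_betw ((pick I)(k := pick J j)) {k} {pick J j}" by (auto simp: bij_betw_def)
    ultimately have "bij_betw ((pick I)(k := pick J j)) (({..<d} - {k}) \<union> {k}) ((I - {e}) \<union> {pick J j})"
      using \<open>pick J j \<notin> I\<close> by (intro bij_betw_combine) auto
    moreover have "({..<d} - {k}) \<union> {k} = {..<d}" using k by auto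
    ultimately show ?thesis by simp
  qed
  then have "\<bar>minor d X id ((pick I)(k := pick J j))\<bar> = \<bar>maximal_minor X (insert (pick J j) (I - {e}))\<bar>"
    using I J iJ by (intro maximal_minor_reindex[OF X]) auto
  then have "maximal_minor X (insert (pick J j) (I - {e})) \<noteq> 0" using j(2) by (metis abs_eq_0)
  with \<open>pick J j \<notin> I\<close> iJ show ?thesis by blast
qed

text \<open>
  A minor isomorphic to the uniform matroid of rank 2 on 4 points, obtained by contracting \<open>S\<close>.
\<close>

definition has_U24_minor :: "nat \<Rightarrow> nat \<Rightarrow> (nat set \<Rightarrow> bool) \<Rightarrow> bool" where
  "has_U24_minor d N basis \<longleftrightarrow> (\<exists>S a b c e. S \<subseteq> {..<N} \<and> Suc (Suc (card S)) = d \<and>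
     {a, b, c, e} \<subseteq> {..<N} - S \<and> distinct [a, b, c, e] \<and>
     (\<forall>x\<in>{a, b, c, e}. \<forall>y\<in>{a, b, c, e}. x \<noteq> y \<longrightarrow> basis (insert x (insert y S))))"

text \<open>
  If the minors of \<open>Y\<close> are, up to sign, the images of those of \<open>X\<close> under a multiplicative map, then both
  three-term relations hold for the same triple of products. The two fields may differ: \<open>Y\<close> is either
  the candidate \<open>X\<^sub>k\<close> or a real unimodular matrix with \<open>\<phi> = 1\<close>.
\<close>

lemma U24_minor_balanced_triple:
  fixes X :: "'a::linordered_field mat" and Y :: "'b::linordered_field mat"
  assumes X: "X \<in> carrier_mat d N" and Y: "Y \<in> carrier_mat d N"
    and U: "has_U24_minor d N (\<lambda>I. maximal_minor X I \<noteq> 0)"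
    and phi: "\<And>I. I \<subseteq> {..<N} \<Longrightarrow> card I = d \<Longrightarrow> maximal_minor X I \<noteq> 0 \<Longrightarrow> \<bar>maximal_minor Y I\<bar> = \<phi> \<bar>maximal_minor X I\<bar>"
    and mult: "\<And>x y. x > 0 \<Longrightarrow> y > 0 \<Longrightarrow> \<phi> (x * y) = \<phi> x * \<phi> y"
  obtains p q r where "p > 0" "q > 0" "r > 0" "balanced p q r" "balanced (\<phi> p) (\<phi> q) (\<phi> r)"
proof -
  obtain S a b c e where "S \<subseteq> {..<N} \<and> Suc (Suc (card S)) = d \<and>
     {a, b, c, e} \<subseteq> {..<N} - S \<and> distinct [a, b, c, e] \<and>
     (\<forall>x\<in>{a, b, c, e}. \<forall>y\<in>{a, b, c, e}. x \<noteq> y \<longrightarrow> maximal_minor X (insert x (insert y S)) \<noteq> 0)"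
    using U unfolding has_U24_minor_def by (elim exE) (rule that)
  then have *: "S \<subseteq> {..<N}" "Suc (Suc (card S)) = d" "{a, b, c, e} \<subseteq> {..<N} - S" "distinct [a, b, c, e]"
    and nz: "\<forall>x\<in>{a, b, c, e}. \<forall>y\<in>{a, b, c, e}. x \<noteq> y \<longrightarrow> maximal_minor X (insert x (insert y S)) \<noteq> 0"
    by - (elim conjE, assumption)+
  define F where "F = (\<lambda>x y. \<bar>maximal_minor X (insert x (insert y S))\<bar>)"
  define G where "G = (\<lambda>x y. \<bar>maximal_minor Y (insert x (insert y S))\<bar>)"
  have fin: "finite S" using * finite_subset by blast
  have F: "F x y > 0" "G x y = \<phi> (F x y)" if xy: "x \<in> {a, b, c, e}" "y \<in> {a, b, c, e}" "x \<noteq> y" for x y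
  proof -
    have "x \<notin> S" "y \<notin> S" using xy *(3) by blast+
    then have "card (insert x (insert y S)) = d" using xy(3) fin *(2) by simp
    moreover have "insert x (insert y S) \<subseteq> {..<N}" using xy *(1,3) by blast
    ultimately show "F x y > 0" "G x y = \<phi> (F x y)" using phi nz[rule_format, OF xy] unfolding F_def G_def by auto
  qed
  let ?p = "F a b * F c e" and ?q = "F a c * F b e" and ?r = "F a e * F b c"
  have "balanced ?p ?q ?r" unfolding F_def by (rule three_term_balanced[OF X *])
  moreover have "balanced (G a b * G c e) (G a c * G b e) (G a e * G b c)"
    unfolding G_def by (rule three_term_balanced[OF Y *])
  moreover have "G a b * G c e = \<phi> ?p" "G a c * G b e = \<phi> ?q" "G a e * G b c = \<phi> ?r"
    using *(4) F by (simp_all add: mult)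
  moreover have "?p > 0" "?q > 0" "?r > 0" using *(4) F by simp_all
  ultimately show thesis using that by simp
qed

lemma binary_valuation_minors:
  fixes X :: "'a::linordered_field mat"
  assumes X: "X \<in> carrier_mat d N" and noU: "\<not> has_U24_minor d N (\<lambda>I. maximal_minor X I \<noteq> 0)"
  shows "binary_valuation {..<N} (\<lambda>I. if I \<subseteq> {..<N} \<and> card I = d then \<bar>maximal_minor X I\<bar> else 0)"
proof
  let ?f = "\<lambda>I. if I \<subseteq> {..<N} \<and> card I = d then \<bar>maximal_minor X I\<bar> else 0"
  show "finite {..<N}" by simp
  show "?f I \<ge> 0" for I by simp
  show "?f I \<noteq> 0 \<Longrightarrow> I \<subseteq> {..<N}" for I by (auto split: if_splits)
  show "\<exists>i\<in>J - I. ?f (insert i (I - {e})) \<noteq> 0" if f: "?f I \<noteq> 0" "?f J \<noteq> 0" and e: "e \<in> I - J" for I J e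
  proof -
    have IJ: "I \<subseteq> {..<N}" "card I = d" "maximal_minor X I \<noteq> 0" "J \<subseteq> {..<N}" "card J = d" "maximal_minor X J \<noteq> 0"
      using f by (auto split: if_splits)
    obtain i where i: "i \<in> J - I" "maximal_minor X (insert i (I - {e})) \<noteq> 0"
      using minor_exchange[OF X IJ e] by blast
    have "finite I" using IJ finite_subset by blast
    then have "card (insert i (I - {e})) = d"
      using i e IJ(2) by (metis DiffD1 DiffD2 card.remove card_insert_disjoint finite_Diff insertE insert_Diff)
    moreover have "insert i (I - {e}) \<subseteq> {..<N}" using i IJ by auto
    ultimately show ?thesis using i by auto
  qed
  show "degenerate_three_term (?f (insert a (insert b S)) * ?f (insert c (insert e S)))
             (?f (insert a (insert c S)) * ?f (insert b (insert e S)))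
             (?f (insert a (insert e S)) * ?f (insert b (insert c S)))"
    if d: "distinct [a, b, c, e]" "{a, b, c, e} \<inter> S = {}" for a b c e S
  proof (cases "insert a (insert b (insert c (insert e S))) \<subseteq> {..<N} \<and> Suc (Suc (card S)) = d")
    case True
    then have S: "S \<subseteq> {..<N}" "Suc (Suc (card S)) = d" and el: "{a, b, c, e} \<subseteq> {..<N} - S"
      using d by auto
    have fin: "finite S" using S finite_subset by blast
    have val: "?f (insert x (insert y S)) = \<bar>maximal_minor X (insert x (insert y S))\<bar>"
      if "x \<in> {a, b, c, e}" "y \<in> {a, b, c, e}" "x \<noteq> y" for x y
    proof -
      have "x \<notin> S" "y \<notin> S" using that d(2) by auto
      then have "card (insert x (insert y S)) = d" using that fin S(2) by simp
      moreover have "insert x (insert y S) \<subseteq> {..<N}" using that S el by auto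
      ultimately show ?thesis by simp
    qed
    have "\<exists>x\<in>{a, b, c, e}. \<exists>y\<in>{a, b, c, e}. x \<noteq> y \<and> maximal_minor X (insert x (insert y S)) = 0"
    proof (rule ccontr)
      assume "\<not> ?thesis"
      then have nz: "maximal_minor X (insert x (insert y S)) \<noteq> 0"
        if "x \<in> {a, b, c, e}" "y \<in> {a, b, c, e}" "x \<noteq> y" for x y
        using that by meson
      have "has_U24_minor d N (\<lambda>I. maximal_minor X I \<noteq> 0)" unfolding has_U24_minor_def
        by (intro exI[of _ S] exI[of _ a] exI[of _ b] exI[of _ c] exI[of _ e] conjI S el d(1) ballI impI nz)
      then show False using noU by simp
    qed
    then obtain x y where xy: "x \<in> {a, b, c, e}" "y \<in> {a, b, c, e}" "x \<noteq> y"
      "maximal_minor X (insert x (insert y S)) = 0" by meson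
    have b: "balanced (?f (insert a (insert b S)) * ?f (insert c (insert e S)))
             (?f (insert a (insert c S)) * ?f (insert b (insert e S)))
             (?f (insert a (insert e S)) * ?f (insert b (insert c S)))"
      using three_term_balanced[OF X S el d(1)] d(1) val by simp
    have "?f (insert x (insert y S)) = 0" "?f (insert y (insert x S)) = 0"
      using xy val by (simp_all add: insert_commute)
    then have "?f (insert a (insert b S)) * ?f (insert c (insert e S)) = 0 \<or>
       ?f (insert a (insert c S)) * ?f (insert b (insert e S)) = 0 \<or>
       ?f (insert a (insert e S)) * ?f (insert b (insert c S)) = 0"
      using xy(1-3) by (auto simp: insert_commute)
    moreover have "?f I * ?f J \<ge> 0" for I J by simp
    ultimately show ?thesis using b unfolding balanced_def degenerate_three_term_def
      by (smt (verit, ccfv_SIG) add_0 add_nonneg_eq_0_iff add.commute)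
  next
    case False
    have vanish: "?f (insert x (insert y S)) * ?f (insert z (insert w S)) = 0"
      if that: "{x, y, z, w} = {a, b, c, e}" "x \<noteq> y" for x y z w
    proof (rule ccontr)
      assume "\<not> ?thesis"
      then have *: "insert x (insert y S) \<subseteq> {..<N}" "insert z (insert w S) \<subseteq> {..<N}" "card (insert x (insert y S)) = d"
        by (auto split: if_splits)
      have "x \<notin> S" "y \<notin> S" using that(1) d(2) by auto
      moreover have "finite S" using * finite_subset by auto
      moreover note \<open>x \<noteq> y\<close>
      ultimately have "Suc (Suc (card S)) = d" using * by simp
      moreover have "insert a (insert b (insert c (insert e S))) = {x, y, z, w} \<union> S" unfolding that(1) by auto
      ultimately show False using False * by auto
    qed
    have "?f (insert a (insert b S)) * ?f (insert c (insert e S)) = 0"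
      "?f (insert a (insert c S)) * ?f (insert b (insert e S)) = 0"
      "?f (insert a (insert e S)) * ?f (insert b (insert c S)) = 0"
      by (rule vanish; use d(1) in auto)+
    then show ?thesis unfolding degenerate_three_term_def by (intro disjI1 conjI) (simp_all only:)
  qed
qed

section \<open>Column matroids\<close>

lemma submatrix_columns:
  assumes "S \<subseteq> {..<dim_col A}"
  shows "submatrix A UNIV S = mat (dim_row A) (card S) (\<lambda>(i, j). A $$ (i, pick S j))"
    and "j < card S \<Longrightarrow> pick S j < dim_col A"
proof -
  have "{i. i < dim_row A \<and> i \<in> UNIV} = {..<dim_row A}" "{j. j < dim_col A \<and> j \<in> S} = S" using assms by auto
  then show "submatrix A UNIV S = mat (dim_row A) (card S) (\<lambda>(i, j). A $$ (i, pick S j))"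
    unfolding submatrix_def by (simp add: pick_UNIV)
  show "j < card S \<Longrightarrow> pick S j < dim_col A" using assms pick_in_set_le[of j S] by auto
qed

text \<open>
  The rank functions are compared on arbitrary lists \<open>g\<close> of columns, which avoids the increasing
  enumeration of a set.
\<close>

lemma column_matroid_eqI:
  assumes A: "A \<in> carrier_mat r N" and B: "B \<in> carrier_mat s N"
    and "\<And>g n. g ` {..<n} \<subseteq> {..<N} \<Longrightarrow>
      vec_space.rank r (mat r n (\<lambda>(i, j). A $$ (i, g j))) = vec_space.rank s (mat s n (\<lambda>(i, j). B $$ (i, g j)))"
  shows "column_matroid A = column_matroid B"
proof -
  have "vec_space.rank (dim_row A) (submatrix A UNIV S) = vec_space.rank (dim_row B) (submatrix B UNIV S)"
    if "S \<subseteq> {..<N}" for S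
    using submatrix_columns[of S A] submatrix_columns[of S B] that A B assms(3)[of "pick S" "card S"]
    by (simp add: image_subset_iff)
  then show ?thesis unfolding column_matroid_def using A B by (auto intro!: restrict_ext)
qed

lemma rank_scale_columns_le:
  fixes A :: "'a::field mat"
  assumes A: "A \<in> carrier_mat r c"
  shows "vec_space.rank r (mat r c (\<lambda>(i, j). A $$ (i, j) * a j)) \<le> vec_space.rank r A"
proof -
  let ?k = "vec_space.rank r A"
  obtain \<rho> W where W: "W \<in> carrier_mat r ?k" and eq: "A = W * mat ?k c (\<lambda>(i, j). A $$ (\<rho> i, j))"
    by (rule rank_factorization[OF A])
  have "A $$ (i, j) = (\<Sum>k<?k. W $$ (i, k) * A $$ (\<rho> k, j))" if "i < r" "j < c" for i j
    using that W by (subst eq) (simp add: scalar_prod_def atLeast0LessThan)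
  then have "mat r c (\<lambda>(i, j). A $$ (i, j) * a j) = W * mat ?k c (\<lambda>(i, j). A $$ (\<rho> i, j) * a j)"
    using W by (intro eq_matI) (auto simp: scalar_prod_def atLeast0LessThan sum_distrib_right mult.assoc)
  then show ?thesis using rank_le_inner_dim[OF W, of "mat ?k c (\<lambda>(i, j). A $$ (\<rho> i, j) * a j)" c] by simp
qed

lemma column_matroid_scale:
  fixes A :: "'a::field mat"
  assumes A: "A \<in> carrier_mat r N" and a: "\<And>j. a j \<noteq> 0"
  shows "column_matroid (mat r N (\<lambda>(i, j). A $$ (i, j) * a j)) = column_matroid A"
proof (rule column_matroid_eqI[OF _ A])
  show "mat r N (\<lambda>(i, j). A $$ (i, j) * a j) \<in> carrier_mat r N" by simp
  fix g and n :: nat assume g: "g ` {..<n} \<subseteq> {..<N}"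
  let ?B = "mat r n (\<lambda>(i, j). mat r N (\<lambda>(i, j). A $$ (i, j) * a j) $$ (i, g j))"
  let ?A = "mat r n (\<lambda>(i, j). A $$ (i, g j))"
  have B: "?B = mat r n (\<lambda>(i, j). ?A $$ (i, j) * a (g j))" using g by (intro eq_matI) auto
  have A': "?A = mat r n (\<lambda>(i, j). ?B $$ (i, j) * (1 / a (g j)))" using g a by (intro eq_matI) auto
  have "vec_space.rank r ?B \<le> vec_space.rank r ?A"
    by (subst B) (rule rank_scale_columns_le[OF mat_carrier])
  moreover have "vec_space.rank r ?A \<le> vec_space.rank r ?B"
    by (subst A') (rule rank_scale_columns_le[OF mat_carrier])
  ultimately show "vec_space.rank r ?B = vec_space.rank r ?A" by simp
qed

lemma column_matroid_row_operation:
  fixes A :: "'a::field mat"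
  assumes A: "A \<in> carrier_mat r N" and T: "T \<in> carrier_mat s r" "T' \<in> carrier_mat r s" "T' * T = 1\<^sub>m r"
  shows "column_matroid (T * A) = column_matroid A"
proof (rule column_matroid_eqI[OF _ A])
  show "T * A \<in> carrier_mat s N" using A T by simp
  fix g and n :: nat assume g: "g ` {..<n} \<subseteq> {..<N}"
  let ?B = "mat s n (\<lambda>(i, j). (T * A) $$ (i, g j))"
  let ?A = "mat r n (\<lambda>(i, j). A $$ (i, g j))"
  have B: "?B = T * ?A" using g A T by (intro eq_matI) (auto simp: scalar_prod_def)
  have "?A = (T' * T) * ?A" using T by simp
  also have "\<dots> = T' * ?B" unfolding B by (rule assoc_mult_mat[of T' r s T r ?A n]) (use T in auto)
  finally have A': "?A = T' * ?B" .
  have "vec_space.rank s ?B \<le> vec_space.rank r ?A" unfolding B by (rule rank_mult_le[OF T(1) mat_carrier])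
  moreover have "vec_space.rank r ?A \<le> vec_space.rank s ?B" 
    using rank_mult_le[OF T(2), of ?B n] A' by simp
  ultimately show "vec_space.rank s ?B = vec_space.rank r ?A" by simp
qed

lemma minor_of_int:
  assumes "\<rho> ` {..<n} \<subseteq> {..<dim_row A}" "\<gamma> ` {..<n} \<subseteq> {..<dim_col A}"
  shows "minor n (map_mat of_int A :: 'a::comm_ring_1 mat) \<rho> \<gamma> = of_int (minor n A \<rho> \<gamma>)"
proof -
  have "mat n n (\<lambda>(i, j). (map_mat of_int A :: 'a mat) $$ (\<rho> i, \<gamma> j)) = map_mat of_int (mat n n (\<lambda>(i, j). A $$ (\<rho> i, \<gamma> j)))"
    using assms by (intro eq_matI) (auto simp: image_subset_iff)
  then show ?thesis unfolding minor_def by simp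
qed

text \<open>
  A minor of an integer matrix is nonzero over both fields or over neither. The fields may be
  interchanged, so the ranks agree.
\<close>

lemma rank_of_int_le:
  fixes A :: "int mat"
  assumes A: "A \<in> carrier_mat r c"
  shows "vec_space.rank r (map_mat of_int A :: 'a::field_char_0 mat) \<le>
         vec_space.rank r (map_mat of_int A :: 'b::field_char_0 mat)"
proof -
  let ?A = "map_mat of_int A :: 'a mat" and ?B = "map_mat of_int A :: 'b mat"
  have c: "?A \<in> carrier_mat r c" "?B \<in> carrier_mat r c" using A by auto
  obtain \<rho> \<gamma> where *: "\<rho> ` {..<vec_space.rank r ?A} \<subseteq> {..<r}" "\<gamma> ` {..<vec_space.rank r ?A} \<subseteq> {..<c}"
    "minor (vec_space.rank r ?A) ?A \<rho> \<gamma> \<noteq> 0"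
    by (rule rank_factorization[OF c(1)])
  then have "minor (vec_space.rank r ?A) ?B \<rho> \<gamma> \<noteq> 0"
    using A by (simp add: minor_of_int)
  then show ?thesis by (rule rank_ge_if_minor[OF c(2) _ *(1,2)])
qed

lemma column_matroid_of_int:
  fixes A :: "int mat"
  assumes A: "A \<in> carrier_mat r N"
  shows "column_matroid (map_mat of_int A :: 'a::field_char_0 mat) = column_matroid (map_mat of_int A :: 'b::field_char_0 mat)"
proof (rule column_matroid_eqI)
  show "(map_mat of_int A :: 'a mat) \<in> carrier_mat r N" "(map_mat of_int A :: 'b mat) \<in> carrier_mat r N"
    using A by auto
  fix g and n :: nat assume g: "g ` {..<n} \<subseteq> {..<N}"
  let ?A = "mat r n (\<lambda>(i, j). A $$ (i, g j))"
  have eqs: "mat r n (\<lambda>(i, j). (map_mat of_int A :: 'a mat) $$ (i, g j)) = map_mat of_int ?A"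
    "mat r n (\<lambda>(i, j). (map_mat of_int A :: 'b mat) $$ (i, g j)) = map_mat of_int ?A"
    using g A by (auto intro!: eq_matI simp: image_subset_iff)
  show "vec_space.rank r (mat r n (\<lambda>(i, j). (map_mat of_int A :: 'a mat) $$ (i, g j))) =
     vec_space.rank r (mat r n (\<lambda>(i, j). (map_mat of_int A :: 'b mat) $$ (i, g j)))"
    unfolding eqs by (intro le_antisym rank_of_int_le[OF mat_carrier])
qed

section \<open>Total unimodularity and regularity\<close>

lemma minor_unit_column:
  assumes "\<And>i. i < n \<Longrightarrow> A $$ (\<rho> i, \<gamma> n) = 0" "A $$ (\<rho> n, \<gamma> n) = 1"
  shows "minor (Suc n) A \<rho> \<gamma> = minor n A \<rho> \<gamma>"
proof -
  let ?M = "mat (Suc n) (Suc n) (\<lambda>(i, j). A $$ (\<rho> i, \<gamma> j))"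
  have "minor (Suc n) A \<rho> \<gamma> = (\<Sum>i<Suc n. ?M $$ (i, n) * cofactor ?M i n)"
    unfolding minor_def by (rule laplace_expansion_column) auto
  also have "\<dots> = cofactor ?M n n" using assms by simp
  also have "\<dots> = minor n A \<rho> \<gamma>"
    unfolding cofactor_def mat_delete_def minor_def by (auto intro!: arg_cong[of _ _ det] eq_matI)
  finally show ?thesis .
qed

text \<open>
  Downward induction on the size: a minor of size \<open>m < d\<close> misses some row \<open>r\<close>, and adjoining row \<open>r\<close>
  together with the unit column \<open>u r\<close> does not change its value.
\<close>

lemma unimodular_with_identity_minors:
  fixes Z :: "'a::comm_ring_1 mat"
  assumes unit: "\<And>i r. i < d \<Longrightarrow> r < d \<Longrightarrow> Z $$ (i, u r) = (if i = r then 1 else 0)"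
    and u: "\<And>r. r < d \<Longrightarrow> u r < N"
    and max: "\<And>\<gamma>. \<gamma> ` {..<d} \<subseteq> {..<N} \<Longrightarrow> minor d Z id \<gamma> \<in> {0, 1, -1}"
    and "m \<le> d" "\<rho> ` {..<m} \<subseteq> {..<d}" "\<gamma> ` {..<m} \<subseteq> {..<N}"
  shows "minor m Z \<rho> \<gamma> \<in> {0, 1, -1}"
  using assms(4-6)
proof (induction m arbitrary: \<rho> \<gamma> rule: inc_induct)
  case base
  show ?case
  proof (cases "inj_on \<rho> {..<d}")
    case True
    then have "\<rho> ` {..<d} = id ` {..<d}" using base(1) endo_inj_surj[of "{..<d}" \<rho>] by simp
    then show ?thesis using minor_same_rows[OF True, of id Z \<gamma>] max[OF base(2)] by auto
  next
    case False
    then show ?thesis using minor_nonzero_inj(1) by blast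
  qed
next
  case (step m)
  have "card (\<rho> ` {..<m}) < card {..<d}" using step.hyps card_image_le[of "{..<m}" \<rho>] by simp
  then obtain r where r: "r < d" "r \<notin> \<rho> ` {..<m}"
    using step.prems(1) by (metis lessThan_iff less_irrefl subsetI subset_antisym)
  have rows: "\<rho> i < d" "\<rho> i \<noteq> r" if "i < m" for i using that step.prems(1) r(2) by auto
  have "minor (Suc m) Z (\<rho>(m := r)) (\<gamma>(m := u r)) = minor m Z (\<rho>(m := r)) (\<gamma>(m := u r))"
    using unit r(1) rows by (intro minor_unit_column) auto
  also have "\<dots> = minor m Z \<rho> \<gamma>" by (rule minor_cong) auto
  finally have "minor m Z \<rho> \<gamma> = minor (Suc m) Z (\<rho>(m := r)) (\<gamma>(m := u r))" by simp
  also have "\<dots> \<in> {0, 1, -1}"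
    using step.prems r(1) u by (intro step.IH) (auto simp: less_Suc_eq image_subset_iff)
  finally show ?case .
qed

lemma inverse_matrix_exists:
  fixes B :: "'a::field mat"
  assumes B: "B \<in> carrier_mat n n" and nz: "det B \<noteq> 0"
  obtains T where "T \<in> carrier_mat n n" "T * B = 1\<^sub>m n" "B * T = 1\<^sub>m n"
proof -
  note adj = adj_mat[OF B]
  have TB: "(1 / det B) \<cdot>\<^sub>m adj_mat B * B = 1\<^sub>m n"
    unfolding mult_smult_assoc_mat[OF adj(1) B] adj(3) using nz by (intro eq_matI) auto
  show thesis
    by (rule that[of "(1 / det B) \<cdot>\<^sub>m adj_mat B"]) (use adj B TB mat_mult_left_right_inverse[OF _ B TB] in auto)
qed

lemma totally_unimodular_minor:
  assumes TU: "totally_unimodular A" and "\<rho> ` {..<n} \<subseteq> {..<dim_row A}" "\<gamma> ` {..<n} \<subseteq> {..<dim_col A}"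
  shows "minor n A \<rho> \<gamma> \<in> {0, 1, -1}"
proof (cases "minor n A \<rho> \<gamma> = 0")
  case nz: False
  let ?I = "\<rho> ` {..<n}" and ?J = "\<gamma> ` {..<n}"
  note inj = minor_nonzero_inj[OF nz]
  have card: "card ?I = n" "card ?J = n" using inj by (simp_all add: card_image)
  have pick: "bij_betw (pick ?I) {..<n} ?I" "bij_betw (pick ?J) {..<n} ?J"
    using card by (simp_all add: bij_betw_pick)
  have "minor n A \<rho> \<gamma> = minor n A (pick ?I) \<gamma> \<or> minor n A \<rho> \<gamma> = - minor n A (pick ?I) \<gamma>"
    using pick(1) by (intro minor_same_rows inj) (auto simp: bij_betw_def)
  moreover have "minor n A (pick ?I) \<gamma> = minor n A (pick ?I) (pick ?J) \<or>
      minor n A (pick ?I) \<gamma> = - minor n A (pick ?I) (pick ?J)"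
    using pick(2) by (intro minor_same_columns inj) (auto simp: bij_betw_def)
  ultimately have rel: "minor n A \<rho> \<gamma> = minor n A (pick ?I) (pick ?J) \<or>
      minor n A \<rho> \<gamma> = - minor n A (pick ?I) (pick ?J)" by auto
  have "minor n A (pick ?I) (pick ?J) \<noteq> 0" using rel nz by auto
  then have "minor n A (pick ?I) (pick ?J) \<in> {1, -1}"
    using TU assms(2,3) card det_submatrix[OF assms(2,3) card]
    unfolding totally_unimodular_def by metis
  then show ?thesis using rel by auto
qed simp

lemma totally_unimodularI:
  assumes "\<And>n \<rho> \<gamma>. \<rho> ` {..<n} \<subseteq> {..<dim_row A} \<Longrightarrow> \<gamma> ` {..<n} \<subseteq> {..<dim_col A} \<Longrightarrow> n \<le> dim_row A \<Longrightarrow>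
    minor n A \<rho> \<gamma> \<in> {0, 1, -1}"
  shows "totally_unimodular A"
  unfolding totally_unimodular_def
proof (intro allI impI)
  fix I J assume IJ: "I \<subseteq> {..<dim_row A}" "J \<subseteq> {..<dim_col A}" "card I = card J"
    and nz: "det (submatrix A I J) \<noteq> 0"
  have fin: "finite I" "finite J" using IJ finite_subset by blast+
  have "pick I ` {..<card I} = I" "pick J ` {..<card I} = J"
    using bij_betw_pick fin IJ(3) unfolding bij_betw_def by (metis, metis)
  moreover have "card I \<le> dim_row A" using card_mono[OF _ IJ(1)] by simp
  ultimately have "minor (card I) A (pick I) (pick J) \<in> {0, 1, -1}" using assms IJ by metis
  then show "det (submatrix A I J) \<in> {1, -1}"
    using det_submatrix[OF IJ(1,2) refl IJ(3)[symmetric]] nz by auto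
qed

lemma full_rank_basis:
  fixes X :: "'a::linordered_field mat"
  assumes X: "X \<in> carrier_mat d N" and "vec_space.rank d X = d"
  obtains J where "J \<subseteq> {..<N}" "card J = d" "maximal_minor X J \<noteq> 0"
proof -
  obtain \<rho> \<gamma> where *: "\<rho> ` {..<d} \<subseteq> {..<d}" "\<gamma> ` {..<d} \<subseteq> {..<N}" "minor d X \<rho> \<gamma> \<noteq> 0"
    using rank_factorization[OF X] assms(2) by metis
  note inj = minor_nonzero_inj[OF *(3)]
  have "\<rho> ` {..<d} = id ` {..<d}" using endo_inj_surj[OF _ *(1) inj(1)] by simp
  then have "minor d X id \<gamma> \<noteq> 0" using minor_same_rows[OF inj(1), of id X \<gamma>] *(3) by auto
  moreover have "bij_betw \<gamma> {..<d} (\<gamma> ` {..<d})" using inj(2) by (simp add: bij_betw_def)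
  ultimately have "maximal_minor X (\<gamma> ` {..<d}) \<noteq> 0"
    using maximal_minor_reindex[OF X _ *(2)] by fastforce
  then show thesis using that *(2) inj(2) by (simp add: card_image)
qed

text \<open>
  Rescaled by \<open>h\<close>, the columns give \<open>Y\<close> with maximal minors \<open>0, \<plusminus>1/c\<close>. Multiplying by the
  inverse of a basis of columns gives \<open>Z\<close>, whose maximal minors are \<open>0, \<plusminus>1\<close> and which contains the
  identity, so it is totally unimodular. Its entries are integers, which transports it to \<open>\<real>\<close>.
\<close>

lemma regular_if_rescalable:
  fixes X :: "'a::linordered_field mat"
  assumes X: "X \<in> carrier_mat d N" and rank: "vec_space.rank d X = d"
    and c: "c > 0" and h: "\<And>x. h x > 0"
    and unit: "\<And>I. I \<subseteq> {..<N} \<Longrightarrow> card I = d \<Longrightarrow> maximal_minor X I \<noteq> 0 \<Longrightarrow> c * \<bar>maximal_minor X I\<bar> * prod h I = 1"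
  shows "regular_matroid (column_matroid X)"
proof -
  define Y where "Y = mat d N (\<lambda>(i, j). X $$ (i, j) * h j)"
  have Y: "Y \<in> carrier_mat d N" by (simp add: Y_def)
  obtain J where J: "J \<subseteq> {..<N}" "card J = d" "maximal_minor X J \<noteq> 0"
    using full_rank_basis[OF X rank] .
  have finJ: "finite J" using J finite_subset by blast
  have pJ: "pick J r < N" if "r < d" for r using pick_in_set_le[of r J] J that by auto
  have Y_minor: "c * \<bar>minor d Y id g\<bar> \<in> {0, 1}" if g: "g ` {..<d} \<subseteq> {..<N}" for g
  proof (cases "minor d Y id g = 0")
    case False
    have "minor d Y id g = prod h (g ` {..<d}) * minor d X id g"
    proof -
      have "minor d Y id g = (\<Prod>i<d. 1) * (\<Prod>j<d. h (g j)) * minor d X id g"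
        unfolding Y_def using minor_scale[of d id d g N "\<lambda>_. 1" X h] g by (simp add: image_subset_iff)
      then show ?thesis using minor_nonzero_inj(2)[OF False] by (simp add: prod.reindex)
    qed
    moreover have "bij_betw g {..<d} (g ` {..<d})"
      using minor_nonzero_inj(2)[OF False] by (simp add: bij_betw_def)
    note maximal_minor_reindex[OF X this g]
    moreover have "card (g ` {..<d}) = d" using minor_nonzero_inj(2)[OF False] by (simp add: card_image)
    moreover have "prod h (g ` {..<d}) > 0" using h by (simp add: prod_pos)
    ultimately show ?thesis using unit[OF g] False by (auto simp: abs_mult mult_ac)
  qed simp
  define B where "B = mat d d (\<lambda>(i, j). Y $$ (i, pick J j))"
  have B: "B \<in> carrier_mat d d" by (simp add: B_def)
  have "minor d Y id (pick J) = (\<Prod>i<d. 1) * (\<Prod>j<d. h (pick J j)) * minor d X id (pick J)"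
    unfolding Y_def using minor_scale[of d id d "pick J" N "\<lambda>_. 1" X h] pJ by simp
  moreover have "(\<Prod>j<d. h (pick J j)) \<noteq> 0"
    using prod_pos[of "{..<d}" "\<lambda>j. h (pick J j)"] h by (metis less_irrefl)
  ultimately have detB: "det B \<noteq> 0" "det B = minor d Y id (pick J)"
    using maximal_minor_eq[OF X J(1,2)] J(3) by (simp_all add: B_def minor_def del: prod_zero_iff)
  then have cB: "c * \<bar>det B\<bar> = 1" using Y_minor[of "pick J"] pJ c by (auto simp: image_subset_iff)
  obtain T where T: "T \<in> carrier_mat d d" "T * B = 1\<^sub>m d" "B * T = 1\<^sub>m d"
    using inverse_matrix_exists[OF B detB(1)] .
  define Z where "Z = T * Y"
  have Z: "Z \<in> carrier_mat d N" using T Y by (simp add: Z_def)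
  have unitZ: "Z $$ (i, pick J r) = (if i = r then 1 else 0)" if "i < d" "r < d" for i r
  proof -
    have "Z $$ (i, pick J r) = (T * B) $$ (i, r)"
      unfolding Z_def B_def using that T Y pJ by (simp add: scalar_prod_def)
    then show ?thesis using T(2) that by simp
  qed
  have "det T * det B = 1" using det_mult[OF T(1) B] T(2) by simp
  then have detT: "\<bar>det T\<bar> = c" using cB detB(1)
    by (metis abs_1 abs_mult mult_right_cancel abs_eq_0)
  have Z_minor: "minor d Z id g \<in> {0, 1, -1}" if "g ` {..<d} \<subseteq> {..<N}" for g
  proof -
    have "minor d Z id g = minor d T id id * minor d Y id g"
      unfolding Z_def using that by (intro minor_mult[OF T(1) Y]) (auto simp: image_subset_iff)
    moreover have "minor d T id id = det T" unfolding minor_def using T(1) by (auto intro!: arg_cong[of _ _ det] eq_matI)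
    ultimately have "\<bar>minor d Z id g\<bar> \<in> {0, 1}" using Y_minor[OF that] detT by (simp add: abs_mult)
    then show ?thesis by (auto simp: abs_if split: if_splits)
  qed
  note Z_minors = unimodular_with_identity_minors[OF unitZ pJ Z_minor]
  define Zi where "Zi = mat d N (\<lambda>(i, j). if Z $$ (i, j) = 0 then 0 else if Z $$ (i, j) = 1 then 1 else -1 :: int)"
  have Zi: "Zi \<in> carrier_mat d N" by (simp add: Zi_def)
  have ZZi: "Z = map_mat of_int Zi"
  proof (rule eq_matI)
    fix i j assume "i < dim_row (map_mat of_int Zi)" "j < dim_col (map_mat of_int Zi)"
    then have ij: "i < d" "j < N" using Zi by auto
    have "minor 1 Z (\<lambda>_. i) (\<lambda>_. j) \<in> {0, 1, -1}" using ij by (intro Z_minors) auto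
    then have "Z $$ (i, j) \<in> {0, 1, -1}" by (simp add: minor_def det_single)
    then show "Z $$ (i, j) = map_mat of_int Zi $$ (i, j)" using ij by (auto simp: Zi_def)
  qed (use Z Zi in auto)
  let ?R = "map_mat of_int Zi :: real mat"
  have "totally_unimodular ?R"
  proof (rule totally_unimodularI)
    fix n \<rho> \<gamma> assume *: "\<rho> ` {..<n} \<subseteq> {..<dim_row ?R}" "\<gamma> ` {..<n} \<subseteq> {..<dim_col ?R}" "n \<le> dim_row ?R"
    then have "minor n Z \<rho> \<gamma> \<in> {0, 1, -1}" using Zi by (intro Z_minors) auto
    moreover have "minor n Z \<rho> \<gamma> = of_int (minor n Zi \<rho> \<gamma>)" unfolding ZZi using * by (intro minor_of_int) auto
    ultimately have "of_int (minor n Zi \<rho> \<gamma>) \<in> (of_int ` {0, 1, -1} :: 'a set)" by simp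
    then have "minor n Zi \<rho> \<gamma> \<in> {0, 1, -1}" by (metis imageE of_int_eq_iff)
    moreover have "minor n ?R \<rho> \<gamma> = of_int (minor n Zi \<rho> \<gamma>)" using * by (intro minor_of_int) auto
    ultimately show "minor n ?R \<rho> \<gamma> \<in> {0, 1, -1}" by auto
  qed
  moreover have "column_matroid ?R = column_matroid X"
  proof -
    have "column_matroid ?R = column_matroid Z" unfolding ZZi by (rule column_matroid_of_int[OF Zi])
    also have "\<dots> = column_matroid Y" unfolding Z_def by (rule column_matroid_row_operation[OF Y T(1) B T(3)])
    also have "\<dots> = column_matroid X" unfolding Y_def
      using h by (intro column_matroid_scale[OF X]) (simp add: less_imp_neq[THEN not_sym])
    finally show ?thesis .
  qed
  ultimately show ?thesis unfolding regular_matroid_def represents_def by blast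
qed

text \<open>
  A totally unimodular representation \<open>M\<close> may have more than \<open>d\<close> rows. Since its rank is \<open>d\<close>, it
  factors as \<open>W * A\<close> with \<open>A\<close> consisting of \<open>d\<close> of its rows. For a basis \<open>I\<close> some \<open>d \<times> d\<close> minor of the
  columns \<open>I\<close> of \<open>M\<close> is nonzero, and it is a multiple of the corresponding minor of \<open>A\<close>.
\<close>

lemma regular_unimodular_companion:
  fixes X :: "'a::linordered_field mat"
  assumes X: "X \<in> carrier_mat d N" and rank: "vec_space.rank d X = d"
    and reg: "regular_matroid (column_matroid X)"
  obtains A :: "real mat" where "A \<in> carrier_mat d N"
    "\<And>I. I \<subseteq> {..<N} \<Longrightarrow> card I = d \<Longrightarrow> maximal_minor X I \<noteq> 0 \<Longrightarrow> \<bar>maximal_minor A I\<bar> = 1"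
proof -
  obtain M :: "real mat" where TU: "totally_unimodular M" and M: "column_matroid M = column_matroid X"
    using reg unfolding regular_matroid_def represents_def by blast
  define r where "r = dim_row M"
  have "{..<dim_col M} = {..<dim_col X}" using M unfolding column_matroid_def by simp
  then have N: "dim_col M = N" using X by (metis card_lessThan carrier_matD(2))
  have Mc: "M \<in> carrier_mat r N" using N by (auto simp: r_def)
  have ranks: "vec_space.rank r (submatrix M UNIV S) = vec_space.rank d (submatrix X UNIV S)" if "S \<subseteq> {..<N}" for S
  proof -
    have "snd (column_matroid M) S = snd (column_matroid X) S" using M by simp
    then show ?thesis using that N X by (simp add: column_matroid_def r_def)
  qed
  have all: "submatrix C UNIV {..<N} = C" if "C \<in> carrier_mat s N" for C :: "'b mat" and s
  proof -
    have "pick {..<N} j = j" if "j < N" for j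
      using pick_card_in_set[of j "{..<N}"] that by (simp add: Collect_conj_eq lessThan_def[symmetric] min_def Int_absorb1)
    then show ?thesis using submatrix_columns(1)[of "{..<N}" C] that by (auto intro!: eq_matI)
  qed
  have rM: "vec_space.rank r M = d" using ranks[of "{..<N}"] all[OF Mc] all[OF X] rank by simp
  obtain \<rho> W where \<rho>: "\<rho> ` {..<d} \<subseteq> {..<r}" and W: "W \<in> carrier_mat r d"
    and MW: "M = W * mat d N (\<lambda>(i, j). M $$ (\<rho> i, j))"
    using rank_factorization[OF Mc] rM by metis
  define A where "A = mat d N (\<lambda>(i, j). M $$ (\<rho> i, j))"
  have A: "A \<in> carrier_mat d N" by (simp add: A_def)
  have "\<bar>maximal_minor A I\<bar> = 1" if I: "I \<subseteq> {..<N}" "card I = d" "maximal_minor X I \<noteq> 0" for I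
  proof -
    let ?XI = "submatrix X UNIV I" and ?MI = "submatrix M UNIV I"
    have finI: "finite I" using I finite_subset by blast
    have pI: "pick I j \<in> I" "pick I j < N" if "j < d" for j
      using pick_in_set_le[of j I] I that by auto
    have XI: "?XI \<in> carrier_mat d d" using submatrix_columns(1)[of I X] I X by simp
    have "minor d ?XI id id = det ?XI"
      unfolding minor_def using XI by (auto intro!: arg_cong[of _ _ det] eq_matI)
    then have "d \<le> vec_space.rank d ?XI"
      using I(3) unfolding maximal_minor_def by (intro rank_ge_if_minor[OF XI, of d id id]) auto
    moreover have MI: "?MI \<in> carrier_mat r d" using submatrix_columns(1)[of I M] I N by (simp add: r_def)
    moreover have "vec_space.rank r ?MI \<le> d" by (rule vec_space.rank_le_nc[OF MI])
    ultimately have "vec_space.rank r ?MI = d" using ranks[OF I(1)] by simp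
    then obtain \<rho>' \<gamma> where *: "\<rho>' ` {..<d} \<subseteq> {..<r}" "\<gamma> ` {..<d} \<subseteq> {..<d}" "minor d ?MI \<rho>' \<gamma> \<noteq> 0"
      using rank_factorization[OF MI] by metis
    have g: "bij_betw (pick I \<circ> \<gamma>) {..<d} I"
    proof (rule bij_betw_trans)
      show "bij_betw \<gamma> {..<d} {..<d}"
        using minor_nonzero_inj(2)[OF *(3)] endo_inj_surj[OF _ *(2)] by (simp add: bij_betw_def)
      show "bij_betw (pick I) {..<d} I" by (rule bij_betw_pick[OF finI I(2)])
    qed
    have "minor d ?MI \<rho>' \<gamma> = minor d M \<rho>' (pick I \<circ> \<gamma>)"
      using submatrix_columns(1)[of I M] I N * by (intro minor_cong) (auto simp: r_def image_subset_iff)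
    also have "\<dots> = minor d W \<rho>' id * minor d A id (pick I \<circ> \<gamma>)"
      using MW A * pI unfolding A_def[symmetric]
      by (subst MW[folded A_def], intro minor_mult[OF W A]) (auto simp: image_subset_iff)
    finally have "minor d A id (pick I \<circ> \<gamma>) \<noteq> 0" using *(3) by auto
    moreover have "minor d A id (pick I \<circ> \<gamma>) = minor d M \<rho> (pick I \<circ> \<gamma>)"
      using * pI by (intro minor_cong) (auto simp: A_def image_subset_iff)
    moreover have "minor d M \<rho> (pick I \<circ> \<gamma>) \<in> {0, 1, -1}"
      using \<rho> * pI N by (intro totally_unimodular_minor[OF TU]) (auto simp: r_def image_subset_iff)
    ultimately have "\<bar>minor d A id (pick I \<circ> \<gamma>)\<bar> = 1" by auto
    then show ?thesis using maximal_minor_reindex[OF A g I(1)] by simp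
  qed
  then show thesis using that[OF A] by blast
qed

lemma regular_no_U24:
  fixes X :: "'a::linordered_field mat"
  assumes X: "X \<in> carrier_mat d N" and rank: "vec_space.rank d X = d"
    and reg: "regular_matroid (column_matroid X)"
  shows "\<not> has_U24_minor d N (\<lambda>I. maximal_minor X I \<noteq> 0)"
proof
  assume U: "has_U24_minor d N (\<lambda>I. maximal_minor X I \<noteq> 0)"
  obtain A :: "real mat" where A: "A \<in> carrier_mat d N"
    "\<And>I. I \<subseteq> {..<N} \<Longrightarrow> card I = d \<Longrightarrow> maximal_minor X I \<noteq> 0 \<Longrightarrow> \<bar>maximal_minor A I\<bar> = 1"
    using regular_unimodular_companion[OF X rank reg] by metis
  show False
    by (rule U24_minor_balanced_triple[OF X A(1) U, of "\<lambda>_. 1"]) (use A(2) in \<open>auto simp: balanced_def\<close>)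
qed

section \<open>Powers of minors\<close>

text \<open>
  The two alternatives of the last axiom are, for \<open>\<phi> x = x\<^sup>k\<close>, the cases \<open>k > 1\<close> and \<open>0 \<le> k < 1\<close>. Only positive arguments are
  constrained; the value of the power at \<open>0\<close> is handled separately.
\<close>

locale nonlinear_power =
  fixes \<phi> :: "'a::linordered_field \<Rightarrow> 'a"
  assumes pos: "x > 0 \<Longrightarrow> \<phi> x > 0"
    and mult: "x > 0 \<Longrightarrow> y > 0 \<Longrightarrow> \<phi> (x * y) = \<phi> x * \<phi> y"
    and unit_interval: "(\<forall>t\<in>{0<..<1}. \<phi> t < t) \<or> (\<forall>t\<in>{0<..<1}. t < \<phi> t \<and> \<phi> t \<le> 1)"
begin

lemma one: "\<phi> 1 = 1"
  using mult[of 1 1] pos[of 1] by simp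

lemma prod: "(\<And>x. x \<in> A \<Longrightarrow> h x > 0) \<Longrightarrow> \<phi> (prod h A) = (\<Prod>x\<in>A. \<phi> (h x))"
proof (induction A rule: infinite_finite_induct)
  case (insert x A)
  then show ?case using mult[of "h x" "prod h A"] by (simp add: prod_pos)
qed (simp_all add: one)

text \<open>
  With \<open>s = x + y\<close> and \<open>t = x / s\<close>, multiplicativity reduces the claim to \<open>\<phi> t + \<phi> (1 - t) \<noteq> 1\<close> and
  \<open>\<phi> t \<le> 1\<close>.
\<close>

lemma not_additive:
  assumes "x > 0" "y > 0"
  shows "\<phi> (x + y) \<noteq> \<phi> x + \<phi> y" "\<phi> x \<noteq> \<phi> (x + y) + \<phi> y"
proof -
  define s t where "s = x + y" and "t = x / (x + y)"
  have s: "s > 0" "\<phi> s > 0" and t: "t \<in> {0<..<1}" "1 - t \<in> {0<..<1}" and xy: "x = t * s" "y = (1 - t) * s"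
    using assms pos[of "x + y"] by (auto simp: s_def t_def field_simps)
  have phi: "\<phi> x = \<phi> t * \<phi> s" "\<phi> y = \<phi> (1 - t) * \<phi> s"
    unfolding xy using t s by (auto intro!: mult)
  have "\<phi> t + \<phi> (1 - t) \<noteq> 1 \<and> \<phi> t \<le> 1"
    using unit_interval
  proof
    assume "\<forall>t\<in>{0<..<1}. \<phi> t < t"
    then have "\<phi> t < t" "\<phi> (1 - t) < 1 - t" using t by blast+
    then show ?thesis using t by auto
  next
    assume "\<forall>t\<in>{0<..<1}. t < \<phi> t \<and> \<phi> t \<le> 1"
    then have "t < \<phi> t" "1 - t < \<phi> (1 - t)" "\<phi> t \<le> 1" using t by blast+
    then show ?thesis by auto
  qed
  then have "\<phi> t + \<phi> (1 - t) \<noteq> 1" "\<phi> t \<le> 1" by auto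
  then show "\<phi> (x + y) \<noteq> \<phi> x + \<phi> y"
    unfolding phi s_def[symmetric] using s by (metis distrib_right less_irrefl mult_cancel_right2)
  have "\<phi> x \<le> \<phi> s" unfolding phi
    using mult_right_mono[OF \<open>\<phi> t \<le> 1\<close>, of "\<phi> s"] s by simp
  then show "\<phi> x \<noteq> \<phi> (x + y) + \<phi> y" using pos[OF assms(2)] by (simp add: s_def)
qed

lemma not_balanced:
  assumes "p > 0" "q > 0" "r > 0" "balanced p q r" shows "\<not> balanced (\<phi> p) (\<phi> q) (\<phi> r)"
proof -
  have "\<not> balanced (\<phi> (x + y)) (\<phi> x) (\<phi> y)" if "x > 0" "y > 0" for x y
    using not_additive[OF that] not_additive[OF that(2,1)] unfolding balanced_def by (auto simp: add.commute)
  moreover have "balanced a b c \<longleftrightarrow> balanced b a c" "balanced a b c \<longleftrightarrow> balanced c a b" for a b c :: 'a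
    unfolding balanced_def by (auto simp: add.commute)
  ultimately show ?thesis using assms(4) unfolding balanced_def[of p q r] by (metis assms(1-3))
qed

text \<open>
  Each side excludes a four-point line, and the absence of a four-point line yields the scaling from which
  both a totally unimodular matrix and \<open>X\<^sub>k\<close> are built.
\<close>

theorem regular_iff_power_of_minors:
  assumes X: "X \<in> carrier_mat d N" and rank: "vec_space.rank d X = d"
  shows "regular_matroid (column_matroid X) \<longleftrightarrow>
    (\<exists>Xk\<in>carrier_mat d N. \<forall>I. I \<subseteq> {..<N} \<longrightarrow> card I = d \<longrightarrow>
       (if maximal_minor X I = 0 then 0 else \<phi> \<bar>maximal_minor X I\<bar>) = \<bar>maximal_minor Xk I\<bar>)"
    (is "_ \<longleftrightarrow> ?powers")
proof -
  let ?U = "has_U24_minor d N (\<lambda>I. maximal_minor X I \<noteq> 0)"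
  have "\<not> ?U" if "?powers"
  proof
    assume U: ?U
    from that obtain Y where Y: "Y \<in> carrier_mat d N"
      "\<And>I. I \<subseteq> {..<N} \<Longrightarrow> card I = d \<Longrightarrow> (if maximal_minor X I = 0 then 0 else \<phi> \<bar>maximal_minor X I\<bar>) = \<bar>maximal_minor Y I\<bar>"
      by blast
    show False
    proof (rule U24_minor_balanced_triple[OF X Y(1) U, of \<phi>])
      show "\<bar>maximal_minor Y I\<bar> = \<phi> \<bar>maximal_minor X I\<bar>"
        if "I \<subseteq> {..<N}" "card I = d" "maximal_minor X I \<noteq> 0" for I using Y(2)[OF that(1,2)] that(3) by simp
    qed (use mult not_balanced in auto)
  qed
  moreover have "regular_matroid (column_matroid X) \<and> ?powers" if noU: "\<not> ?U"
  proof -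
    define f where "f I = (if I \<subseteq> {..<N} \<and> card I = d then \<bar>maximal_minor X I\<bar> else 0)" for I
    interpret binary_valuation "{..<N}" f
      unfolding f_def by (rule binary_valuation_minors[OF X noU])
    obtain c :: 'a and h :: "nat \<Rightarrow> 'a" where c: "c > 0" and h: "\<And>x. h x > 0"
      and unit: "\<And>I. f I \<noteq> 0 \<Longrightarrow> c * f I * prod h I = 1"
      using rescale_to_unit by metis
    have unit': "c * \<bar>maximal_minor X I\<bar> * prod h I = 1"
      if "I \<subseteq> {..<N}" "card I = d" "maximal_minor X I \<noteq> 0" for I
      using unit[of I] that by (simp add: f_def)
    \<comment> \<open>On bases \<open>\<bar>\<Delta>\<^sub>I(X)\<bar> = 1/c \<Prod>\<^sub>i\<^sub>\<in>\<^sub>I 1/h\<^sub>i\<close>, so multiplying row \<open>0\<close> by \<open>\<psi> (1/c)\<close>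
      and column \<open>i\<close> by \<open>\<psi> (1/h\<^sub>i)\<close> multiplies this minor by \<open>\<psi> \<bar>\<Delta>\<^sub>I(X)\<bar>\<close>.\<close>
    define \<psi> where "\<psi> x = \<phi> x / x" for x
    have \<psi>_mult: "\<psi> (x * y) = \<psi> x * \<psi> y" if "x > 0" "y > 0" for x y
      using mult[OF that] by (simp add: \<psi>_def)
    have \<psi>_prod: "(\<Prod>x\<in>A. \<psi> (1 / h x)) = \<psi> (\<Prod>x\<in>A. 1 / h x)" for A :: "nat set"
      using prod[of A "\<lambda>x. 1 / h x"] h unfolding \<psi>_def prod_dividef by simp
    define Y where "Y = mat d N (\<lambda>(i, j). (if i = 0 then \<psi> (1 / c) else 1) * X $$ (i, j) * \<psi> (1 / h j))"
    have Y: "Y \<in> carrier_mat d N" by (simp add: Y_def)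
    have "(if maximal_minor X I = 0 then 0 else \<phi> \<bar>maximal_minor X I\<bar>) = \<bar>maximal_minor Y I\<bar>"
      if I: "I \<subseteq> {..<N}" "card I = d" for I
    proof -
      have finI: "finite I" using I finite_subset by blast
      note bij = bij_betw_pick[OF finI I(2)]
      have pI: "pick I j < N" if "j < d" for j using pick_in_set_le[of j I] I that by auto
      have "maximal_minor Y I = (\<Prod>i<d. if i = 0 then \<psi> (1 / c) else 1) * (\<Prod>j<d. \<psi> (1 / h (pick I j))) * minor d X id (pick I)"
        unfolding maximal_minor_eq[OF Y I] unfolding Y_def
        using minor_scale[of d id d "pick I" N "\<lambda>i. if i = 0 then \<psi> (1 / c) else 1" X "\<lambda>j. \<psi> (1 / h j)"] pI
        by simp
      also have "(\<Prod>j<d. \<psi> (1 / h (pick I j))) = (\<Prod>j\<in>I. \<psi> (1 / h j))"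
        using prod.reindex_bij_betw[OF bij, of "\<lambda>j. \<psi> (1 / h j)"] by simp
      finally have Y_minor: "maximal_minor Y I =
        (\<Prod>i<d. if i = 0 then \<psi> (1 / c) else 1) * \<psi> (\<Prod>x\<in>I. 1 / h x) * maximal_minor X I"
        unfolding \<psi>_prod maximal_minor_eq[OF X I] .
      show ?thesis
      proof (cases "maximal_minor X I = 0")
        case nz: False
        have hI: "prod h I > 0" using h by (simp add: prod_pos)
        have "(\<Prod>i<d. if i = 0 then \<psi> (1 / c) else 1) = \<psi> (1 / c)"
        proof (cases "d = 0")
          \<comment> \<open>There is no row to scale, but the empty minor is \<open>1\<close>, which forces \<open>c = 1\<close>.\<close>
          case True
          then have "I = {}" using I finI by simp
          then have "c = 1" using unit'[OF I nz] True maximal_minor_eq[OF X I] by simp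
          then show ?thesis using True by (simp add: \<psi>_def one)
        qed (simp add: prod.delta)
        moreover have "\<bar>maximal_minor X I\<bar> = 1 / c * (\<Prod>x\<in>I. 1 / h x)"
          using unit'[OF I nz] c hI by (simp add: prod_dividef field_simps)
        moreover have "(\<Prod>x\<in>I. 1 / h x) > 0" using h by (simp add: prod_pos)
        ultimately have "maximal_minor Y I = \<psi> \<bar>maximal_minor X I\<bar> * maximal_minor X I"
          using Y_minor \<psi>_mult[of "1 / c" "\<Prod>x\<in>I. 1 / h x"] c by simp
        moreover have "\<psi> \<bar>maximal_minor X I\<bar> > 0" using nz pos by (simp add: \<psi>_def)
        ultimately show ?thesis using nz by (simp add: abs_mult) (simp add: \<psi>_def)
      qed (simp add: Y_minor)
    qed
    then show ?thesis using regular_if_rescalable[OF X rank c h unit'] Y by blast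
  qed
  ultimately show ?thesis using regular_no_U24[OF X rank] by blast
qed

end

lemma nonlinear_power_powr:
  assumes "0 \<le> k" "k \<noteq> 1"
  shows "nonlinear_power (\<lambda>x::real. x powr k)"
proof
  show "(\<forall>t::real\<in>{0<..<1}. t powr k < t) \<or> (\<forall>t::real\<in>{0<..<1}. t < t powr k \<and> t powr k \<le> 1)"
  proof (cases "k < 1")
    case True
    have "t < t powr k \<and> t powr k \<le> 1" if "t \<in> {0<..<1}" for t :: real
      using that powr_less_mono'[of t k 1] True powr_le1[of k t] assms(1) by auto
    then show ?thesis by blast
  next
    case False
    have "t powr k < t" if "t \<in> {0<..<1}" for t :: real
      using that powr_less_mono'[of t 1 k] False assms(2) by auto
    then show ?thesis by blast
  qed
qed (auto simp: powr_mult)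

lemma nonlinear_power_nat:
  assumes "k \<noteq> 1"
  shows "nonlinear_power (\<lambda>x::'a::linordered_field. x ^ k)"
proof
  show "(\<forall>t::'a\<in>{0<..<1}. t ^ k < t) \<or> (\<forall>t::'a\<in>{0<..<1}. t < t ^ k \<and> t ^ k \<le> 1)"
  proof (cases "k = 0")
    case False
    have "t ^ k < t" if "t \<in> {0<..<1}" for t :: 'a
      using that power_strict_decreasing[of 1 k t] False assms
      by (metis greaterThanLessThan_iff less_one linorder_neqE_nat power_one_right)
    then show ?thesis by blast
  qed auto
qed (rule zero_less_power, assumption, rule power_mult_distrib)

theorem theorem1p1:
  shows "(\<forall>(d::nat) (N::nat) (X::real mat) (k::real).
            d \<le> N \<longrightarrow> X \<in> carrier_mat d N \<longrightarrow> vec_space.rank d X = d \<longrightarrow> 0 \<le> k \<longrightarrow> k \<noteq> 1 \<longrightarrow>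
            (regular_matroid (column_matroid X) \<longleftrightarrow>
             (\<exists>Xk\<in>carrier_mat d N. \<forall>I. I \<subseteq> {..<N} \<longrightarrow> card I = d \<longrightarrow>
                \<bar>maximal_minor X I\<bar> powr k = \<bar>maximal_minor Xk I\<bar>)))
       \<and> (\<forall>(d::nat) (N::nat) (X::'a::linordered_field mat) (k::nat).
            d \<le> N \<longrightarrow> X \<in> carrier_mat d N \<longrightarrow> vec_space.rank d X = d \<longrightarrow> k \<noteq> 1 \<longrightarrow>
            (regular_matroid (column_matroid X) \<longleftrightarrow>
             (\<exists>Xk\<in>carrier_mat d N. \<forall>I. I \<subseteq> {..<N} \<longrightarrow> card I = d \<longrightarrow>
                power_zero \<bar>maximal_minor X I\<bar> k = \<bar>maximal_minor Xk I\<bar>)))"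
proof (intro conjI allI impI)
  fix d N :: nat and X :: "real mat" and k :: real
  assume X: "X \<in> carrier_mat d N" "vec_space.rank d X = d" and k: "0 \<le> k" "k \<noteq> 1"
  have eq: "(if x = 0 then 0 else \<bar>x\<bar> powr k) = \<bar>x\<bar> powr k" for x by simp
  show "regular_matroid (column_matroid X) \<longleftrightarrow>
    (\<exists>Xk\<in>carrier_mat d N. \<forall>I. I \<subseteq> {..<N} \<longrightarrow> card I = d \<longrightarrow> \<bar>maximal_minor X I\<bar> powr k = \<bar>maximal_minor Xk I\<bar>)"
    using nonlinear_power.regular_iff_power_of_minors[OF nonlinear_power_powr[OF k] X] by (simp only: eq)
next
  fix d N :: nat and X :: "'a mat" and k :: nat
  assume X: "X \<in> carrier_mat d N" "vec_space.rank d X = d" and k: "k \<noteq> 1"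
  show "regular_matroid (column_matroid X) \<longleftrightarrow>
    (\<exists>Xk\<in>carrier_mat d N. \<forall>I. I \<subseteq> {..<N} \<longrightarrow> card I = d \<longrightarrow> power_zero \<bar>maximal_minor X I\<bar> k = \<bar>maximal_minor Xk I\<bar>)"
    unfolding power_zero_def abs_eq_0
    by (rule nonlinear_power.regular_iff_power_of_minors[OF nonlinear_power_nat[OF k] X])
qed

end
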